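(* Let $d\ge 1$, let $\|\cdot\|$ be any norm on $\mathbb{R}^d$, with $B(0,1)$ its unit ball, and let $M$ be the associated uncentered maximal operator. (1) For every locally integrable function $f:\mathbb{R}^d\to\mathbb{R}$ and every $t\ge 0$, $$\omega(Mf,t)\le \sup_{\{v\in\mathbb{R}^d:\|v\|=1\}}\ \inf_{\{c\in\mathbb{R}^d,\,R>0:\ \|v-c\|\le R\}}\ \frac{1}{|B(0,1)|}\int_{B(0,1)}\omega\big(|f|,\,t\|c+Ru\|\big)\,du .$$ (2) This inequality is optimal in the following sense: for every modulus of continuity $\omega$ there exists a function $\psi:\mathbb{R}^d\to\mathbb{R}$ such that for all $t>0$ one has $\omega(\psi,t)=\omega(t)$ and $$\omega(M\psi,t)=\sup_{\{v\in\mathbb{R}^d:\|v\|=1\}}\ \inf_{\{c\in\mathbb{R}^d,\,R>0:\ \|v-c\|\le R\}}\ \frac{1}{|B(0,1)|}\int_{B(0,1)}\omega\big(t\|c+Ru\|\big)\,du .$$ (3) For each unit vector $v$ (and each $t>0$), the infimum in the formula of (2) is unchanged if it is taken only over the set $$\{c\in\mathbb{R}^d,\ R>0:\ \|v-c\|=R\ \text{and}\ R\le 1\}.$$ (4) The extremal functions $\psi$ in (2) can be taken of the following form. If $\omega$ is bounded, one can take $\psi(x)=\|\omega\|_{L^\infty([0,\infty))}-\omega(\|x\|)$. If $\omega$ is unbounded, one can take $\psi(x)=\sum_{n=1}^\infty \psi_n(x)$ with $\psi_n(x)=(\Omega_n-\omega(\|x-a_n\|))^+$, where $\{\Omega_n\}_{n\ge1}$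 increases to $\infty$ and the points $a_n\in\mathbb{R}^d$ diverge to infinity so fast that on the support of each spike $\psi_n$ the maximal function of $\psi$ does not depend on any of the other spikes (i.e. $M\psi=M\psi_n$ on the support of $\psi_n$).
   Context: For a norm $\|\cdot\|$ on $\mathbb{R}^d$ and a locally integrable function $f:\mathbb{R}^d\to\mathbb{R}$, the uncentered Hardy-Littlewood maximal function is $Mf(x)=\sup_{B\ni x}\frac1{|B|}\int_B|f(y)|\,dy\in[0,\infty]$, the supremum being over all balls $B$ (of positive finite radius) with respect to $\|\cdot\|$ that contain $x$ (open or closed balls give the same value); $|B|$ is the $d$-dimensional Lebesgue measure. The modulus of continuity of a function $g$ is $\omega(g,\delta)=\sup\{|g(x)-g(y)|:\|x-y\|\le\delta\}\in[0,\infty]$, with distances measured in the same norm $\|\cdot\|$. If $g=Mf$ takes infinite values, $|g(x)-g(y)|$ is interpreted as $0$ when both values are $\infty$. A modulus of continuity is a function $\omega:[0,\infty)\to[0,\infty)$ that is the modulus of continuity of some uniformly continuous function; equivalently, $\omega$ is continuous, nondecreasing, subadditive and $\omega(0)=0$. It is assumed not identically zero. For a real number $a$, $a^+=\max\{a,0\}$. *)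

theory Defs
  imports "HOL-Analysis.Analysis" "HOL-Probability.Essential_Supremum"
begin

definition is_norm :: "(real ^ 'n \<Rightarrow> real) \<Rightarrow> bool" where
  "is_norm N \<longleftrightarrow>
     (\<forall>x. N x \<ge> 0) \<and> (\<forall>x. N x = 0 \<longleftrightarrow> x = 0) \<and>
     (\<forall>a x. N (a *\<^sub>R x) = \<bar>a\<bar> * N x) \<and>
     (\<forall>x y. N (x + y) \<le> N x + N y)"

definition norm_ball :: "(real ^ 'n \<Rightarrow> real) \<Rightarrow> real ^ 'n \<Rightarrow> real \<Rightarrow> (real ^ 'n) set" where
  "norm_ball N c r = {y. N (y - c) \<le> r}"

definition ball_average ::
  "(real ^ 'n \<Rightarrow> real) \<Rightarrow> real ^ 'n \<Rightarrow> real \<Rightarrow> (real ^ 'n \<Rightarrow> ennreal) \<Rightarrow> ennreal" where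
  "ball_average N c r F =
     (\<integral>\<^sup>+ y \<in> norm_ball N c r. F y \<partial>lebesgue) / emeasure lebesgue (norm_ball N c r)"

definition locally_integrable :: "(real ^ 'n \<Rightarrow> real) \<Rightarrow> bool" where
  "locally_integrable f \<longleftrightarrow> (\<forall>K. compact K \<longrightarrow> f absolutely_integrable_on K)"

definition maximal :: "(real ^ 'n \<Rightarrow> real) \<Rightarrow> (real ^ 'n \<Rightarrow> real) \<Rightarrow> real ^ 'n \<Rightarrow> ennreal" where
  "maximal N f x =
     (SUP (c, r) \<in> {(c, r). r > 0 \<and> x \<in> norm_ball N c r}.
        ball_average N c r (\<lambda>y. ennreal \<bar>f y\<bar>))"

text \<open>The case distinction gives two infinite values distance \<open>0\<close>; in \<open>ereal\<close>, \<open>\<infinity> - \<infinity> = \<infinity>\<close>.\<close>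

definition ext_dist :: "ereal \<Rightarrow> ereal \<Rightarrow> ennreal" where
  "ext_dist a b = (if a = b then 0 else e2ennreal \<bar>a - b\<bar>)"

definition modulus :: "(real ^ 'n \<Rightarrow> real) \<Rightarrow> (real ^ 'n \<Rightarrow> ereal) \<Rightarrow> real \<Rightarrow> ennreal" where
  "modulus N g \<delta> = (SUP (x, y) \<in> {(x, y). N (x - y) \<le> \<delta>}. ext_dist (g x) (g y))"

abbreviation modulus_real :: "(real ^ 'n \<Rightarrow> real) \<Rightarrow> (real ^ 'n \<Rightarrow> real) \<Rightarrow> real \<Rightarrow> ennreal" where
  "modulus_real N g \<equiv> modulus N (\<lambda>x. ereal (g x))"

abbreviation modulus_maximal :: "(real ^ 'n \<Rightarrow> real) \<Rightarrow> (real ^ 'n \<Rightarrow> real) \<Rightarrow> real \<Rightarrow> ennreal" where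
  "modulus_maximal N f \<equiv> modulus N (\<lambda>x. enn2ereal (maximal N f x))"

text \<open>Only the values of \<open>\<omega>\<close> on \<open>[0,\<infinity>)\<close> matter. That these are exactly the (nonzero) moduli of
  continuity of uniformly continuous functions is proved in \<open>is_modulus_iff\<close> below.\<close>

definition is_modulus :: "(real \<Rightarrow> real) \<Rightarrow> bool" where
  "is_modulus \<omega> \<longleftrightarrow>
     continuous_on {0..} \<omega> \<and> mono_on {0..} \<omega> \<and>
     (\<forall>s\<ge>0. \<forall>t\<ge>0. \<omega> (s + t) \<le> \<omega> s + \<omega> t) \<and>
     \<omega> 0 = 0 \<and> (\<exists>t\<ge>0. \<omega> t \<noteq> 0)"

definition admissible :: "(real ^ 'n \<Rightarrow> real) \<Rightarrow> real ^ 'n \<Rightarrow> ((real ^ 'n) \<times> real) set" where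
  "admissible N v = {(c, R). R > 0 \<and> N (v - c) \<le> R}"

definition admissible_small :: "(real ^ 'n \<Rightarrow> real) \<Rightarrow> real ^ 'n \<Rightarrow> ((real ^ 'n) \<times> real) set" where
  "admissible_small N v = {(c, R). R > 0 \<and> N (v - c) = R \<and> R \<le> 1}"

text \<open>\<open>\<phi>\<close> is the modulus of \<open>|f|\<close>, which may be infinite, or a given \<open>\<omega>\<close>.\<close>

definition scaled_average ::
  "(real ^ 'n \<Rightarrow> real) \<Rightarrow> (real \<Rightarrow> ennreal) \<Rightarrow> real \<Rightarrow> real ^ 'n \<Rightarrow> real \<Rightarrow> ennreal" where
  "scaled_average N \<phi> t c R = ball_average N 0 1 (\<lambda>u. \<phi> (t * N (c + R *\<^sub>R u)))"

definition modulus_bound ::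
  "(real ^ 'n \<Rightarrow> real) \<Rightarrow> (real \<Rightarrow> ennreal) \<Rightarrow> real \<Rightarrow> ennreal" where
  "modulus_bound N \<phi> t =
     (SUP v \<in> {v. N v = 1}. INF (c, R) \<in> admissible N v. scaled_average N \<phi> t c R)"

definition extremal ::
  "(real ^ 'n \<Rightarrow> real) \<Rightarrow> (real \<Rightarrow> real) \<Rightarrow> (real ^ 'n \<Rightarrow> real) \<Rightarrow> bool" where
  "extremal N \<omega> \<psi> \<longleftrightarrow>
     (\<forall>t>0. modulus_real N \<psi> t = ennreal (\<omega> t) \<and>
            modulus_maximal N \<psi> t = modulus_bound N (\<lambda>s. ennreal (\<omega> s)) t)"

definition Linfty_norm :: "(real \<Rightarrow> real) \<Rightarrow> real" where
  "Linfty_norm \<omega> = real_of_ereal (esssup (lebesgue_on {0..}) (\<lambda>t. ereal \<bar>\<omega> t\<bar>))"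

definition spike ::
  "(real ^ 'n \<Rightarrow> real) \<Rightarrow> (real \<Rightarrow> real) \<Rightarrow> real \<Rightarrow> real ^ 'n \<Rightarrow> real ^ 'n \<Rightarrow> real" where
  "spike N \<omega> h a x = max (h - \<omega> (N (x - a))) 0"

text \<open>Sequences are indexed from \<open>0\<close> instead of \<open>1\<close>.\<close>

definition spike_sum ::
  "(real ^ 'n \<Rightarrow> real) \<Rightarrow> (real \<Rightarrow> real) \<Rightarrow> (nat \<Rightarrow> real) \<Rightarrow> (nat \<Rightarrow> real ^ 'n) \<Rightarrow> real ^ 'n \<Rightarrow> real" where
  "spike_sum N \<omega> \<Omega> a x = (\<Sum>n. spike N \<omega> (\<Omega> n) (a n) x)"

text \<open>Summability makes the series an honest sum; \<open>suminf\<close> is a dummy value otherwise.\<close>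

definition fast_diverging ::
  "(real ^ 'n \<Rightarrow> real) \<Rightarrow> (real \<Rightarrow> real) \<Rightarrow> (nat \<Rightarrow> real) \<Rightarrow> (nat \<Rightarrow> real ^ 'n) \<Rightarrow> bool" where
  "fast_diverging N \<omega> \<Omega> a \<longleftrightarrow>
     filterlim a at_infinity sequentially \<and>
     (\<forall>x. summable (\<lambda>n. spike N \<omega> (\<Omega> n) (a n) x)) \<and>
     (\<forall>n. \<forall>x \<in> closure {x. spike N \<omega> (\<Omega> n) (a n) x \<noteq> 0}.
        maximal N (spike_sum N \<omega> \<Omega> a) x = maximal N (spike N \<omega> (\<Omega> n) (a n)) x)"

lemma is_norm_le_norm:
  assumes "is_norm N"
  obtains C where "C > 0" "\<forall>x. N x \<le> C * norm x"
proof -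
  have sum_le: "N (sum f A) \<le> (\<Sum>i\<in>A. N (f i))" if "finite A" for f :: "'a \<Rightarrow> real ^ 'a" and A
    using that
  proof (induction A rule: finite_induct)
    case empty
    have "N 0 = 0" using assms unfolding is_norm_def by blast
    then show ?case by simp
  next
    case (insert x F)
    have "N (f x + sum f F) \<le> N (f x) + N (sum f F)" using assms by (simp add: is_norm_def)
    then show ?case using insert by simp
  qed
  define K where "K = (\<Sum>i\<in>UNIV. N (axis i 1))"
  have nn: "N x \<ge> 0" for x using assms by (simp add: is_norm_def)
  have K0: "K \<ge> 0" unfolding K_def by (intro sum_nonneg nn)
  have "N x \<le> (K + 1) * norm x" for x
  proof -
    have "x = (\<Sum>i\<in>UNIV. (x $ i) *\<^sub>R axis i 1)"
      by (simp add: vec_eq_iff axis_def if_distrib if_distribR sum.delta cong: if_cong)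
    then have "N x \<le> (\<Sum>i\<in>UNIV. N ((x $ i) *\<^sub>R axis i 1))"
      using sum_le[of UNIV "\<lambda>i. (x $ i) *\<^sub>R axis i 1"] by simp
    also have "\<dots> = (\<Sum>i\<in>UNIV. \<bar>x $ i\<bar> * N (axis i 1))"
      using assms by (simp add: is_norm_def)
    also have "\<dots> \<le> (\<Sum>i\<in>UNIV. norm x * N (axis i 1))"
      by (intro sum_mono mult_right_mono nn) (rule component_le_norm_cart)
    also have "\<dots> = norm x * K" by (simp add: K_def sum_distrib_left)
    also have "\<dots> \<le> (K + 1) * norm x" by (simp add: algebra_simps)
    finally show ?thesis .
  qed
  with K0 show ?thesis by (intro that[of "K + 1"] allI) auto
qed

lemma is_norm_diff:
  assumes "is_norm N"
  shows "\<bar>N x - N y\<bar> \<le> N (x - y)"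
proof -
  have "N x \<le> N (x - y) + N y" for x y
  proof -
    have "N ((x - y) + y) \<le> N (x - y) + N y" using assms unfolding is_norm_def by blast
    then show ?thesis by simp
  qed
  moreover have "N (y - x) = N (x - y)"
  proof -
    have "N ((-1) *\<^sub>R (x - y)) = \<bar>-1\<bar> * N (x - y)" using assms unfolding is_norm_def by blast
    then show ?thesis by simp
  qed
  ultimately show ?thesis by (smt (verit, best))
qed

lemma is_norm_ge_norm:
  assumes "is_norm N"
  obtains c where "c > 0" "\<forall>x. c * norm x \<le> N x"
proof -
  obtain C where C: "C > 0" "\<forall>x. N x \<le> C * norm x" by (rule is_norm_le_norm[OF assms])
  have "C-lipschitz_on UNIV N"
  proof (rule lipschitz_onI)
    fix x y
    show "dist (N x) (N y) \<le> C * dist x y"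
      using is_norm_diff[OF assms, of x y] C(2)[rule_format, of "x - y"] by (simp add: dist_real_def dist_norm)
  qed (use C in simp)
  then have "continuous_on (sphere 0 1) N"
    using lipschitz_on_continuous_on continuous_on_subset by blast
  moreover have "sphere (0 :: real ^ 'a) 1 \<noteq> {}"
    by simp
  ultimately obtain z where z: "z \<in> sphere 0 1" "\<And>y. y \<in> sphere 0 1 \<Longrightarrow> N z \<le> N y"
    using continuous_attains_inf[OF compact_sphere] by metis
  have "N z \<noteq> 0" using z(1) assms by (auto simp: is_norm_def)
  then have "N z > 0" using assms by (simp add: is_norm_def order_less_le)
  moreover have "N z * norm x \<le> N x" for x
  proof (cases "x = 0")
    case False
    have "N z \<le> N ((1 / norm x) *\<^sub>R x)" using False by (intro z(2)) simp
    also have "\<dots> = N x / norm x" using assms by (simp add: is_norm_def)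
    finally show ?thesis using False by (simp add: field_simps)
  qed (use assms in \<open>simp add: is_norm_def\<close>)
  ultimately show ?thesis by (intro that[of "N z"] allI) auto
qed

lemma is_norm_obtain_unit:
  assumes "is_norm N"
  obtains v where "N v = 1"
proof -
  have "N (axis undefined 1) \<noteq> 0" using assms by (simp add: is_norm_def axis_eq_0_iff)
  then have "N ((1 / N (axis undefined 1)) *\<^sub>R axis undefined 1) = 1"
    using assms by (simp add: is_norm_def)
  then show ?thesis by (rule that)
qed

lemma ext_dist_real: "ext_dist (ereal a) (ereal b) = ennreal \<bar>a - b\<bar>"
  by (simp add: ext_dist_def e2ennreal_ereal)

lemma is_modulus_iff:
  fixes N :: "real ^ 'n \<Rightarrow> real"
  assumes "is_norm N"
  shows "is_modulus \<omega> \<longleftrightarrow>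
           (\<forall>t\<ge>0. \<omega> t \<ge> 0) \<and> (\<exists>t\<ge>0. \<omega> t \<noteq> 0) \<and>
           (\<exists>g. uniformly_continuous_on UNIV g \<and> (\<forall>t\<ge>0. modulus_real N g t = ennreal (\<omega> t)))"
    (is "_ \<longleftrightarrow> ?R")
proof
  assume m: "is_modulus \<omega>"
  then have mono: "\<And>s t. 0 \<le> s \<Longrightarrow> s \<le> t \<Longrightarrow> \<omega> s \<le> \<omega> t"
    and sub: "\<And>s t. 0 \<le> s \<Longrightarrow> 0 \<le> t \<Longrightarrow> \<omega> (s + t) \<le> \<omega> s + \<omega> t"
    and z: "\<omega> 0 = 0" and ex: "\<exists>t\<ge>0. \<omega> t \<noteq> 0" and cont: "continuous_on {0..} \<omega>"
    by (auto simp: is_modulus_def mono_on_def)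
  have pos: "\<omega> t \<ge> 0" if "t \<ge> 0" for t using mono[of 0 t] z that by simp
  have nn: "N x \<ge> 0" for x using assms by (simp add: is_norm_def)
  define g where "g x = \<omega> (N x)" for x
  have diff: "\<bar>g x - g y\<bar> \<le> \<omega> (N (x - y))" for x y
  proof -
    have *: "\<omega> a - \<omega> b \<le> \<omega> \<bar>a - b\<bar>" if "a \<ge> 0" "b \<ge> 0" for a b
    proof -
      have "\<omega> a \<le> \<omega> (b + \<bar>a - b\<bar>)" using that by (intro mono) auto
      also have "\<dots> \<le> \<omega> b + \<omega> \<bar>a - b\<bar>" using that by (intro sub) auto
      finally show ?thesis by simp
    qed
    have "\<bar>g x - g y\<bar> \<le> \<omega> \<bar>N x - N y\<bar>"
      using *[of "N x" "N y"] *[of "N y" "N x"] nn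
      by (simp add: g_def abs_minus_commute abs_le_iff)
    also have "\<dots> \<le> \<omega> (N (x - y))" using is_norm_diff[OF assms] by (intro mono) auto
    finally show ?thesis .
  qed
  have "uniformly_continuous_on UNIV g"
    unfolding uniformly_continuous_on_def
  proof (intro allI impI)
    fix e :: real assume e: "e > 0"
    obtain C where C: "C > 0" "\<forall>x. N x \<le> C * norm x" by (rule is_norm_le_norm[OF assms])
    obtain d where d: "d > 0" "\<And>s. s \<ge> 0 \<Longrightarrow> s < d \<Longrightarrow> \<omega> s < e"
    proof -
      obtain d where "d > 0" "\<forall>s\<in>{0..}. dist s 0 < d \<longrightarrow> dist (\<omega> s) (\<omega> 0) < e"
        using cont[unfolded continuous_on_iff, rule_format, of 0 e] e by auto
      then show ?thesis using that[of d] z by (auto simp: dist_real_def abs_less_iff)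
    qed
    show "\<exists>d>0. \<forall>x\<in>UNIV. \<forall>x'\<in>UNIV. dist x' x < d \<longrightarrow> dist (g x') (g x) < e"
    proof (intro exI[of _ "d / C"] conjI ballI impI)
      fix x x' :: "real ^ 'n" assume "dist x' x < d / C"
      then have "C * norm (x' - x) < d" using C by (simp add: dist_norm field_simps)
      then have "N (x' - x) < d" using C(2)[rule_format, of "x' - x"] by simp
      then show "dist (g x') (g x) < e"
        using diff[of x' x] d(2)[of "N (x' - x)"] nn by (simp add: dist_real_def)
    qed (use C d in simp)
  qed
  moreover have "modulus_real N g t = ennreal (\<omega> t)" if t: "t \<ge> 0" for t
  proof (rule antisym)
    show "modulus_real N g t \<le> ennreal (\<omega> t)"
      unfolding modulus_def
    proof (rule SUP_least, clarsimp simp: ext_dist_real)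
      fix x y assume "N (x - y) \<le> t"
      then have "\<bar>g x - g y\<bar> \<le> \<omega> t" using diff[of x y] mono[of "N (x - y)" t] nn by force
      then show "ennreal \<bar>g x - g y\<bar> \<le> ennreal (\<omega> t)" by (rule ennreal_leI)
    qed
    obtain v where v: "N v = 1" by (rule is_norm_obtain_unit[OF assms])
    have Nt: "N (t *\<^sub>R v) = t" "N 0 = 0" using assms v t by (auto simp: is_norm_def)
    have "ennreal (\<omega> t) = ext_dist (ereal (g (t *\<^sub>R v))) (ereal (g 0))"
      using pos[OF t] by (simp add: ext_dist_real g_def Nt z)
    also have "\<dots> \<le> modulus_real N g t"
      unfolding modulus_def by (rule SUP_upper2[of "(t *\<^sub>R v, 0)"]) (auto simp: Nt)
    finally show "ennreal (\<omega> t) \<le> modulus_real N g t" .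
  qed
  ultimately show ?R using pos ex by blast
next
  assume ?R
  then obtain g where pos: "\<And>t. t \<ge> 0 \<Longrightarrow> \<omega> t \<ge> 0" and ex: "\<exists>t\<ge>0. \<omega> t \<noteq> 0"
    and uc: "uniformly_continuous_on UNIV g"
    and eq: "\<And>t. t \<ge> 0 \<Longrightarrow> modulus_real N g t = ennreal (\<omega> t)" by blast
  have nn: "N x \<ge> 0" for x using assms by (simp add: is_norm_def)
  have up: "\<bar>g x - g y\<bar> \<le> \<omega> t" if "N (x - y) \<le> t" for x y t
  proof -
    have t: "t \<ge> 0" using that nn[of "x - y"] by simp
    have "ext_dist (ereal (g x)) (ereal (g y)) \<le> modulus_real N g t"
      unfolding modulus_def by (rule SUP_upper2[of "(x, y)"]) (use that in auto)
    then show ?thesis using eq[OF t] pos[OF t] by (simp add: ext_dist_real)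
  qed
  have least: "\<omega> t \<le> b" if "t \<ge> 0" "b \<ge> 0" "\<And>x y. N (x - y) \<le> t \<Longrightarrow> \<bar>g x - g y\<bar> \<le> b" for t b
  proof -
    have "modulus_real N g t \<le> ennreal b"
      unfolding modulus_def
      by (rule SUP_least) (use that in \<open>auto simp: ext_dist_real intro!: ennreal_leI\<close>)
    then show ?thesis using eq that by simp
  qed
  have z: "\<omega> 0 = 0"
  proof -
    have "\<omega> 0 \<le> 0"
    proof (rule least)
      fix x y assume "N (x - y) \<le> 0"
      then have "N (x - y) = 0" using nn[of "x - y"] by simp
      then have "x = y" using assms by (simp add: is_norm_def)
      then show "\<bar>g x - g y\<bar> \<le> 0" by simp
    qed auto
    then show ?thesis using pos[of 0] by simp
  qed
  have mono: "\<omega> s \<le> \<omega> t" if "0 \<le> s" "s \<le> t" for s t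
    by (rule least) (use that pos up in auto)
  have sub: "\<omega> (s + t) \<le> \<omega> s + \<omega> t" if st: "0 \<le> s" "0 \<le> t" for s t
  proof (cases "s + t = 0")
    case True
    then show ?thesis using st z by (simp add: add_nonneg_eq_0_iff)
  next
    case False
    show ?thesis
    proof (rule least)
      fix x y assume xy: "N (x - y) \<le> s + t"
      define l where "l = s / (s + t)"
      have l: "l \<ge> 0" "1 - l \<ge> 0" "l * (s + t) = s" "(1 - l) * (s + t) = t"
        using st False by (auto simp: l_def field_simps)
      define w where "w = x + l *\<^sub>R (y - x)"
      have e: "x - w = l *\<^sub>R (x - y)" "w - y = (1 - l) *\<^sub>R (x - y)"
        by (auto simp: w_def algebra_simps)
      have "N (x - w) = l * N (x - y)" "N (w - y) = (1 - l) * N (x - y)"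
        unfolding e using assms l by (simp_all add: is_norm_def)
      then have "N (x - w) \<le> s" "N (w - y) \<le> t"
        using mult_left_mono[OF xy l(1)] mult_left_mono[OF xy l(2)] l by auto
      then have "\<bar>g x - g w\<bar> \<le> \<omega> s" "\<bar>g w - g y\<bar> \<le> \<omega> t" using up by auto
      then show "\<bar>g x - g y\<bar> \<le> \<omega> s + \<omega> t" by linarith
    qed (use st pos in auto)
  qed
  have cont: "continuous_on {0..} \<omega>"
    unfolding continuous_on_iff
  proof (intro ballI allI impI)
    fix s e :: real assume s: "s \<in> {0..}" and e: "e > 0"
    obtain d where d: "d > 0" "\<And>x y. dist x y < d \<Longrightarrow> dist (g x) (g y) < e / 2"
      using uc e unfolding uniformly_continuous_on_def by (metis UNIV_I half_gt_zero)
    obtain c where c: "c > 0" "\<forall>x. c * norm x \<le> N x" by (rule is_norm_ge_norm[OF assms])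
    have small: "\<omega> r \<le> e / 2" if "0 \<le> r" "r < c * d" for r
    proof (rule least)
      fix x y assume "N (x - y) \<le> r"
      then have "c * norm (x - y) < c * d" using c(2)[rule_format, of "x - y"] that by simp
      then have "dist x y < d" using c by (simp add: dist_norm)
      then show "\<bar>g x - g y\<bar> \<le> e / 2" using d(2) by (fastforce simp: dist_real_def)
    qed (use that e in auto)
    show "\<exists>d>0. \<forall>x'\<in>{0..}. dist x' s < d \<longrightarrow> dist (\<omega> x') (\<omega> s) < e"
    proof (intro exI[of _ "c * d"] conjI ballI impI)
      fix x' :: real assume x': "x' \<in> {0..}" "dist x' s < c * d"
      have *: "\<omega> b \<le> \<omega> a + \<omega> (b - a)" if "0 \<le> a" "a \<le> b" for a b
        using sub[of a "b - a"] that by simp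
      consider "s \<le> x'" | "x' \<le> s" by linarith
      then show "dist (\<omega> x') (\<omega> s) < e"
      proof cases
        case 1
        then show ?thesis using *[of s x'] mono[of s x'] small[of "x' - s"] s x' e
          by (auto simp: dist_real_def)
      next
        case 2
        then show ?thesis using *[of x' s] mono[of x' s] small[of "s - x'"] s x' e
          by (auto simp: dist_real_def)
      qed
    qed (use c d in simp)
  qed
  show "is_modulus \<omega>"
    unfolding is_modulus_def mono_on_def using cont mono sub z ex by auto
qed

end

theory Submission
  imports Defs
begin

text \<open>The upper bound comes from a matching of balls: for unit \<open>v\<close> and \<open>N (v - c) \<le> R\<close>, a ball
  \<open>(a, r)\<close> containing \<open>x\<close> is compared with the ball \<open>(a - s c, r + s R)\<close>, which contains \<open>x - s v\<close>.
  Points in the same relative position differ by \<open>s (c + R u)\<close> with \<open>N u \<le> 1\<close>, so the averages of \<open>|f|\<close> differ by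
  at most the average of the modulus at \<open>s N (c + R u)\<close>.

  For a spike \<open>h - \<omega> (N (x - a))\<close> all comparisons are equalities when \<open>x = a\<close> is the peak: there
  the maximal function is \<open>h\<close>, and at \<open>a + t v\<close> it is \<open>h\<close> minus the infimum of the averages of
  \<open>min h \<omega>\<close>. Only balls of radius at most \<open>1\<close> matter in this infimum: scaling towards the origin
  brings \<open>v\<close> to the boundary of the ball, and the unit ball around \<open>0\<close> beats every larger ball. Hence the
  truncation at \<open>h\<close> is harmless as soon as \<open>h \<ge> \<omega> (3 t)\<close>, which some spike of the sum satisfies.\<close>

section \<open>Measurability and arithmetic in the presence of infinite values\<close>

text \<open>The modulus of \<open>|f|\<close> may be infinite and need not be continuous, so its
  measurability has to come from monotonicity: superlevel sets of a monotone function on the line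
  are intervals. Composing with \<open>max 0\<close> extends \<open>\<phi>\<close> monotonically to
  the whole line.\<close>

lemma borel_measurable_mono_on_comp:
  fixes \<phi> :: "real \<Rightarrow> ennreal"
  assumes \<phi>: "mono_on {0..} \<phi>" and g: "g \<in> borel_measurable M" and nn: "\<And>x. g x \<ge> 0"
  shows "(\<lambda>x. \<phi> (g x)) \<in> borel_measurable M"
proof -
  have "mono (\<lambda>s. \<phi> (max 0 s))"
    using \<phi> by (intro monoI) (auto simp: mono_on_def)
  then have "is_interval {s. y < \<phi> (max 0 s)}" for y
    unfolding is_interval_1 mono_def by (auto intro: less_le_trans)
  then have "(\<lambda>s. \<phi> (max 0 s)) \<in> borel_measurable borel"
    by (intro borel_measurableI_greater) (auto intro: real_interval_borel_measurable)
  from measurable_compose[OF g this] show ?thesis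
    using nn by (simp add: max_absorb2)
qed

text \<open>Two inequalities without subtraction also cover infinite values: if \<open>e\<close> is
  finite and one of \<open>a\<close>, \<open>b\<close> is infinite, so is the other, and
  \<open>ext_dist\<close> is \<open>0\<close> by convention.\<close>

lemma ext_dist_leI:
  assumes "a \<le> b + e" "b \<le> a + e"
  shows "ext_dist (enn2ereal a) (enn2ereal b) \<le> e"
proof (cases "a = b \<or> e = top")
  case False
  then have "a < top" "b < top" "e < top"
    using assms by (auto simp: less_top[symmetric] ennreal_add_eq_top top_unique)
  then obtain a' b' e' where "a = ennreal a'" "b = ennreal b'" "e = ennreal e'" "a' \<ge> 0" "b' \<ge> 0" "e' \<ge> 0"
    by (metis less_top_ennreal)
  with assms show ?thesis
    by (auto simp: enn2ereal_ennreal ext_dist_real abs_le_iff ennreal_plus[symmetric]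
        simp del: ennreal_plus intro!: ennreal_leI)
qed (auto simp: ext_dist_def)

text \<open>Finiteness of \<open>a\<close> matters: for \<open>a = b = top\<close> the first
  inequality holds for every \<open>e\<close>, while the distance is \<open>0\<close>.\<close>

lemma ext_dist_geI:
  assumes "b + e \<le> a" "a < top"
  shows "e \<le> ext_dist (enn2ereal a) (enn2ereal b)"
proof -
  have "b < top" "e < top"
    using assms by (auto simp: less_top[symmetric] top_unique)
  then obtain a' b' e' where "a = ennreal a'" "b = ennreal b'" "e = ennreal e'" "a' \<ge> 0" "b' \<ge> 0" "e' \<ge> 0"
    using assms(2) by (metis less_top_ennreal)
  with assms show ?thesis
    by (auto simp: enn2ereal_ennreal ext_dist_real ennreal_plus[symmetric]
        simp del: ennreal_plus intro!: ennreal_leI)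
qed

lemma le_add_INF_ennreal:
  fixes c :: ennreal
  assumes "\<And>i. i \<in> I \<Longrightarrow> x \<le> c + f i"
  shows "x \<le> c + (INF i\<in>I. f i)"
proof (cases "c = top")
  case False
  then have "x - c \<le> (INF i\<in>I. f i)"
    using assms by (intro INF_greatest) (simp add: ennreal_minus_le_iff)
  then show ?thesis using False by (simp add: ennreal_minus_le_iff)
qed simp

lemma modulus_mono: "s \<le> t \<Longrightarrow> modulus N g s \<le> modulus N g t"
  unfolding modulus_def by (rule SUP_subset_mono) auto

subsection \<open>Averages over balls of a norm\<close>

locale cart_norm =
  fixes N :: "real ^ 'n \<Rightarrow> real"
  assumes is_norm: "is_norm N"
begin

lemma N_nonneg [simp]: "N x \<ge> 0"
  using is_norm by (simp add: is_norm_def)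

lemma N_eq_0 [simp]: "N x = 0 \<longleftrightarrow> x = 0"
  using is_norm unfolding is_norm_def by blast

lemma N_zero [simp]: "N 0 = 0"
  by simp

lemma N_scaleR [simp]: "N (a *\<^sub>R x) = \<bar>a\<bar> * N x"
  using is_norm by (simp add: is_norm_def)

lemma N_triangle: "N (x + y) \<le> N x + N y"
  using is_norm by (simp add: is_norm_def)

lemma N_minus_commute: "N (x - y) = N (y - x)"
  using N_scaleR[of "-1" "x - y"] by simp

lemma N_minus [simp]: "N (- x) = N x"
  using N_scaleR[of "-1" x] by simp

lemma continuous_on_N: "continuous_on S N"
proof -
  obtain C where C: "C > 0" "\<forall>x. N x \<le> C * norm x" by (rule is_norm_le_norm[OF is_norm])
  have "C-lipschitz_on S N"
  proof (rule lipschitz_onI)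
    fix x y
    show "dist (N x) (N y) \<le> C * dist x y"
      using is_norm_diff[OF is_norm, of x y] C(2)[rule_format, of "x - y"]
      by (simp add: dist_real_def dist_norm)
  qed (use C in simp)
  then show ?thesis by (rule lipschitz_on_continuous_on)
qed

lemma mem_norm_ball: "y \<in> norm_ball N c r \<longleftrightarrow> N (y - c) \<le> r"
  by (simp add: norm_ball_def)

lemma compact_norm_ball: "compact (norm_ball N c r)"
proof -
  have "closed (norm_ball N c r)"
    unfolding norm_ball_def
    by (intro closed_Collect_le continuous_on_compose2[OF continuous_on_N[of UNIV]] continuous_intros) auto
  moreover have "bounded (norm_ball N c r)"
  proof -
    obtain k where k: "k > 0" "\<forall>x. k * norm x \<le> N x" by (rule is_norm_ge_norm[OF is_norm])
    have "norm_ball N c r \<subseteq> cball c (r / k)"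
    proof
      fix y assume "y \<in> norm_ball N c r"
      then have "k * norm (y - c) \<le> r" using k(2)[rule_format, of "y - c"] by (simp add: mem_norm_ball)
      then show "y \<in> cball c (r / k)"
        using k(1) by (simp add: dist_norm norm_minus_commute field_simps)
    qed
    then show ?thesis using bounded_cball bounded_subset by blast
  qed
  ultimately show ?thesis by (simp add: compact_eq_bounded_closed)
qed

lemma sets_norm_ball [measurable]: "norm_ball N c r \<in> sets lebesgue"
  using compact_norm_ball[of c r] by (simp add: borel_compact)

lemma norm_ball_affine:
  assumes "r \<noteq> 0"
  shows "c + r *\<^sub>R u \<in> norm_ball N c \<bar>r\<bar> \<longleftrightarrow> u \<in> norm_ball N 0 1"
  using assms by (simp add: mem_norm_ball)

lemma emeasure_norm_ball:
  assumes "r > 0"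
  shows "emeasure lebesgue (norm_ball N c r) = ennreal (r ^ CARD('n)) * emeasure lebesgue (norm_ball N 0 1)"
proof -
  have "norm_ball N c r = (\<lambda>x. r *\<^sub>R x + c) ` norm_ball N 0 1"
  proof (intro set_eqI iffI)
    fix y assume "y \<in> norm_ball N c r"
    then have "(1 / r) *\<^sub>R (y - c) \<in> norm_ball N 0 1" "y = r *\<^sub>R ((1 / r) *\<^sub>R (y - c)) + c"
      using assms by (auto simp: mem_norm_ball)
    then show "y \<in> (\<lambda>x. r *\<^sub>R x + c) ` norm_ball N 0 1" by blast
  qed (use assms in \<open>auto simp: mem_norm_ball\<close>)
  then show ?thesis using assms by (simp add: emeasure_lebesgue_affine ennreal_power)
qed

lemma emeasure_norm_ball_finite: "emeasure lebesgue (norm_ball N c r) < top"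
  using emeasure_compact_finite[OF compact_norm_ball] by (simp add: borel_compact compact_norm_ball infinity_ennreal_def)

lemma emeasure_norm_ball_pos:
  assumes "r > 0"
  shows "emeasure lebesgue (norm_ball N c r) > 0"
proof -
  obtain C where C: "C > 0" "\<forall>x. N x \<le> C * norm x" by (rule is_norm_le_norm[OF is_norm])
  have "ball c (r / C) \<subseteq> norm_ball N c r"
  proof
    fix y assume "y \<in> ball c (r / C)"
    then have "C * norm (y - c) < r" using C by (simp add: dist_norm norm_minus_commute field_simps)
    then show "y \<in> norm_ball N c r" using C(2)[rule_format, of "y - c"] by (simp add: mem_norm_ball)
  qed
  then have "emeasure lebesgue (ball c (r / C)) \<le> emeasure lebesgue (norm_ball N c r)"
    by (intro emeasure_mono) auto
  moreover have "emeasure lebesgue (ball c (r / C)) > 0"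
    using assms C unit_ball_vol_pos[of "real CARD('n)"] by (simp add: emeasure_ball)
  ultimately show ?thesis by simp
qed

text \<open>As integrals against the uniform measure on the ball, averages inherit additivity and
  the exchange with series.\<close>

lemma ball_average_eq_nn_integral:
  assumes "F \<in> borel_measurable lebesgue"
  shows "ball_average N c r F = (\<integral>\<^sup>+ y. F y \<partial>uniform_measure lebesgue (norm_ball N c r))"
  using assms by (simp add: ball_average_def nn_integral_uniform_measure)

lemma ball_average_mono:
  assumes "\<And>y. y \<in> norm_ball N c r \<Longrightarrow> F y \<le> G y"
  shows "ball_average N c r F \<le> ball_average N c r G"
  unfolding ball_average_def
  by (intro divide_right_mono_ennreal nn_integral_mono) (use assms in \<open>auto simp: indicator_def\<close>)

lemma ball_average_cong:
  assumes "\<And>y. y \<in> norm_ball N c r \<Longrightarrow> F y = G y"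
  shows "ball_average N c r F = ball_average N c r G"
  using assms by (intro antisym ball_average_mono) auto

lemma ball_average_add:
  assumes "F \<in> borel_measurable lebesgue" "G \<in> borel_measurable lebesgue"
  shows "ball_average N c r (\<lambda>y. F y + G y) = ball_average N c r F + ball_average N c r G"
  using assms
  by (simp add: ball_average_eq_nn_integral nn_integral_add)

lemma ball_average_const:
  assumes "r > 0"
  shows "ball_average N c r (\<lambda>_. k) = k"
  using emeasure_norm_ball_pos[OF assms, of c] emeasure_norm_ball_finite[of c r]
  by (simp add: ball_average_eq_nn_integral emeasure_uniform_measure_1[unfolded space_borel])

lemma ball_average_suminf:
  assumes "\<And>i. F i \<in> borel_measurable lebesgue"
  shows "ball_average N c r (\<lambda>y. \<Sum>i. F i y) = (\<Sum>i. ball_average N c r (F i))"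
  using assms by (simp add: ball_average_eq_nn_integral nn_integral_suminf)

lemma measurable_affine_lebesgue [measurable]:
  assumes "r \<noteq> 0"
  shows "(\<lambda>u :: real ^ 'n. c + r *\<^sub>R u) \<in> lebesgue \<rightarrow>\<^sub>M lebesgue"
  using lebesgue_affine_measurable[of "\<lambda>_. r" c] assms
  by (simp add: euclidean_representation flip: scaleR_scaleR scaleR_sum_right)

lemma nn_integral_affine_lebesgue:
  fixes F :: "real ^ 'n \<Rightarrow> ennreal"
  assumes "F \<in> borel_measurable lebesgue" "r \<noteq> 0"
  shows "(\<integral>\<^sup>+ y. F y \<partial>lebesgue) = ennreal (\<bar>r\<bar> ^ CARD('n)) * (\<integral>\<^sup>+ u. F (c + r *\<^sub>R u) \<partial>lebesgue)"
proof -
  have T [measurable]: "(\<lambda>u :: real ^ 'n. c + r *\<^sub>R u) \<in> lebesgue \<rightarrow>\<^sub>M lebesgue"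
    using assms by (intro measurable_affine_lebesgue) auto
  have "lebesgue = density (distr lebesgue lebesgue (\<lambda>u :: real ^ 'n. c + r *\<^sub>R u)) (\<lambda>_. ennreal (\<bar>r\<bar> ^ CARD('n)))"
    using lebesgue_affine_euclidean[of "\<lambda>_. r" c] assms
    by (simp add: euclidean_representation prod_constant flip: scaleR_scaleR scaleR_sum_right)
  then have "(\<integral>\<^sup>+ y. F y \<partial>lebesgue)
      = (\<integral>\<^sup>+ y. F y \<partial>density (distr lebesgue lebesgue (\<lambda>u :: real ^ 'n. c + r *\<^sub>R u)) (\<lambda>_. ennreal (\<bar>r\<bar> ^ CARD('n))))"
    by simp
  also have "\<dots> = ennreal (\<bar>r\<bar> ^ CARD('n)) * (\<integral>\<^sup>+ u. F (c + r *\<^sub>R u) \<partial>lebesgue)"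
    using assms(1)
    by (simp add: nn_integral_density nn_integral_distr nn_integral_cmult)
  finally show ?thesis .
qed

text \<open>Substitution \<open>y = c + r u\<close>; the volume factor cancels in the quotient.
  Negative \<open>r\<close> is allowed because the unit ball is symmetric, and the upper bound uses
  this reflected form.\<close>

lemma ball_average_affine:
  assumes [measurable]: "F \<in> borel_measurable lebesgue" and r: "r \<noteq> 0"
  shows "ball_average N c \<bar>r\<bar> F = ball_average N 0 1 (\<lambda>u. F (c + r *\<^sub>R u))"
proof -
  have r': "\<bar>r\<bar> > 0" using r by simp
  have "(\<integral>\<^sup>+ y \<in> norm_ball N c \<bar>r\<bar>. F y \<partial>lebesgue)
      = ennreal (\<bar>r\<bar> ^ CARD('n)) * (\<integral>\<^sup>+ u. F (c + r *\<^sub>R u) * indicator (norm_ball N c \<bar>r\<bar>) (c + r *\<^sub>R u) \<partial>lebesgue)"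
    using r by (intro nn_integral_affine_lebesgue) auto
  also have "(\<lambda>u. indicator (norm_ball N c \<bar>r\<bar>) (c + r *\<^sub>R u) :: ennreal) = indicator (norm_ball N 0 1)"
    using r by (auto simp: fun_eq_iff indicator_def norm_ball_affine)
  then have "(\<integral>\<^sup>+ u. F (c + r *\<^sub>R u) * indicator (norm_ball N c \<bar>r\<bar>) (c + r *\<^sub>R u) \<partial>lebesgue)
      = (\<integral>\<^sup>+ u \<in> norm_ball N 0 1. F (c + r *\<^sub>R u) \<partial>lebesgue)"
    by (metis (no_types, lifting))
  moreover have "ennreal (\<bar>r\<bar> ^ CARD('n)) * x / (ennreal (\<bar>r\<bar> ^ CARD('n)) * b) = x / b" for x b
    using divide_mult_eq[of "ennreal (\<bar>r\<bar> ^ CARD('n))" x b] r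
    by (simp add: mult.commute[of "ennreal (\<bar>r\<bar> ^ CARD('n))"])
  ultimately show ?thesis
    unfolding ball_average_def emeasure_norm_ball[OF r'] by simp
qed

text \<open>With volumes as real numbers, the volume quotients in the next two estimates reduce to
  real arithmetic.\<close>

lemma obtain_volume:
  obtains m where "m > 0" "\<And>c r. r > 0 \<Longrightarrow> emeasure lebesgue (norm_ball N c r) = ennreal (r ^ CARD('n) * m)"
proof -
  obtain m where "m \<ge> 0" "emeasure lebesgue (norm_ball N 0 1) = ennreal m"
    using emeasure_norm_ball_finite[of 0 1] less_top_ennreal by auto
  then show ?thesis
    using emeasure_norm_ball_pos[of 1 0] emeasure_norm_ball
    by (intro that[of m]) (auto simp: ennreal_mult)
qed

lemma ball_average_ge_subball:
  assumes "norm_ball N c' r' \<subseteq> norm_ball N c r" "r' > 0" "r > 0" "e \<ge> 0"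
    and F: "\<And>y. y \<in> norm_ball N c' r' \<Longrightarrow> ennreal e \<le> F y"
  shows "ennreal (e * (r' / r) ^ CARD('n)) \<le> ball_average N c r F"
proof -
  obtain m where m: "m > 0"
    "\<And>c r. r > 0 \<Longrightarrow> emeasure lebesgue (norm_ball N c r) = ennreal (r ^ CARD('n) * m)"
    by (rule obtain_volume) blast
  have "ennreal (e * (r' ^ CARD('n) * m)) = (\<integral>\<^sup>+ y. ennreal e * indicator (norm_ball N c' r') y \<partial>lebesgue)"
    using assms m by (simp add: nn_integral_cmult_indicator ennreal_mult)
  also have "\<dots> \<le> (\<integral>\<^sup>+ y \<in> norm_ball N c r. F y \<partial>lebesgue)"
    using assms(1) F by (intro nn_integral_mono) (auto simp: indicator_def)
  finally have "ennreal (e * (r' ^ CARD('n) * m)) / ennreal (r ^ CARD('n) * m) \<le> ball_average N c r F"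
    using assms m by (simp add: ball_average_def divide_right_mono_ennreal)
  then show ?thesis
    using assms m by (simp add: divide_ennreal power_divide field_simps)
qed

text \<open>Only the part of the ball inside the support counts, so averages decay as the radius
  grows. This excludes large near-optimal balls and bounds the influence of distant spikes.\<close>

lemma ball_average_le_support:
  assumes "\<rho> > 0" "r > 0" "h \<ge> 0"
    and F: "\<And>y. F y \<le> ennreal h" "\<And>y. y \<notin> norm_ball N z \<rho> \<Longrightarrow> F y = 0"
  shows "ball_average N c r F \<le> ennreal (h * (\<rho> / r) ^ CARD('n))"
proof -
  obtain m where m: "m > 0"
    "\<And>c r. r > 0 \<Longrightarrow> emeasure lebesgue (norm_ball N c r) = ennreal (r ^ CARD('n) * m)"
    by (rule obtain_volume) blast
  have "(\<integral>\<^sup>+ y \<in> norm_ball N c r. F y \<partial>lebesgue) \<le> (\<integral>\<^sup>+ y. ennreal h * indicator (norm_ball N z \<rho>) y \<partial>lebesgue)"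
    using F by (intro nn_integral_mono) (auto simp: indicator_def)
  also have "\<dots> = ennreal (h * (\<rho> ^ CARD('n) * m))"
    using assms m by (simp add: nn_integral_cmult_indicator ennreal_mult)
  finally have "ball_average N c r F \<le> ennreal (h * (\<rho> ^ CARD('n) * m)) / ennreal (r ^ CARD('n) * m)"
    using assms m by (simp add: ball_average_def divide_right_mono_ennreal)
  then show ?thesis
    using assms m by (simp add: divide_ennreal power_divide field_simps)
qed

section \<open>Elementary bounds for the maximal function\<close>

lemma ball_average_le_maximal:
  assumes "r > 0" "N (x - c) \<le> r"
  shows "ball_average N c r (\<lambda>y. ennreal \<bar>f y\<bar>) \<le> maximal N f x"
  unfolding maximal_def using assms by (intro SUP_upper2[of "(c, r)"]) (auto simp: mem_norm_ball)

lemma maximal_leI: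
  assumes "\<And>c r. r > 0 \<Longrightarrow> N (x - c) \<le> r \<Longrightarrow> ball_average N c r (\<lambda>y. ennreal \<bar>f y\<bar>) \<le> b"
  shows "maximal N f x \<le> b"
  unfolding maximal_def using assms by (intro SUP_least) (auto simp: mem_norm_ball)

lemma maximal_mono:
  assumes "\<And>y. \<bar>f y\<bar> \<le> \<bar>g y\<bar>"
  shows "maximal N f x \<le> maximal N g x"
proof (rule maximal_leI)
  fix c r assume "r > 0" "N (x - c) \<le> r"
  then show "ball_average N c r (\<lambda>y. ennreal \<bar>f y\<bar>) \<le> maximal N g x"
    using assms by (intro order_trans[OF ball_average_mono ball_average_le_maximal] ennreal_leI)
qed

lemma maximal_le_bound:
  assumes "\<And>y. \<bar>f y\<bar> \<le> h"
  shows "maximal N f x \<le> ennreal h"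
proof (rule maximal_leI)
  fix c r assume "r > (0::real)"
  then show "ball_average N c r (\<lambda>y. ennreal \<bar>f y\<bar>) \<le> ennreal h"
    using assms ball_average_const[of r c "ennreal h"] ball_average_mono[of c r "\<lambda>y. ennreal \<bar>f y\<bar>" "\<lambda>_. ennreal h"]
    by (simp add: ennreal_leI)
qed

lemma isCont_less_on_norm_ball:
  fixes g :: "real ^ 'n \<Rightarrow> real"
  assumes "isCont g x" "e < g x"
  obtains r where "r > 0" "\<And>y. y \<in> norm_ball N x r \<Longrightarrow> e < g y"
proof -
  have "\<forall>\<^sub>F y in at x. e < g y"
    using assms order_tendstoD(1) unfolding isCont_def by blast
  then obtain d where d: "d > 0" "\<And>y. y \<noteq> x \<Longrightarrow> dist y x < d \<Longrightarrow> e < g y"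
    unfolding eventually_at by auto
  obtain k where k: "k > 0" "\<forall>x. k * norm x \<le> N x" by (rule is_norm_ge_norm[OF is_norm])
  show ?thesis
  proof (rule that)
    show "k * d / 2 > 0" using k d by simp
    fix y assume "y \<in> norm_ball N x (k * d / 2)"
    then have "k * norm (y - x) < k * d"
      using k d k(2)[rule_format, of "y - x"]
      by (smt (verit) mem_norm_ball mult_pos_pos field_sum_of_halves)
    then have "dist y x < d" using k by (simp add: dist_norm)
    then show "e < g y" using d(2) assms(2) by (cases "y = x") auto
  qed
qed

text \<open>By continuity, small balls centred at \<open>x\<close> have averages at least any given
  \<open>e < |f x|\<close>.\<close>

lemma abs_le_maximal:
  assumes "isCont f x"
  shows "ennreal \<bar>f x\<bar> \<le> maximal N f x"
proof (rule dense_le)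
  fix z assume z: "z < ennreal \<bar>f x\<bar>"
  then obtain e where e: "e \<ge> 0" "z = ennreal e"
    by (metis less_top_ennreal order_less_trans ennreal_less_top)
  with z have "e < \<bar>f x\<bar>" by (simp add: ennreal_less_iff)
  then obtain r where r: "r > 0" "\<And>y. y \<in> norm_ball N x r \<Longrightarrow> e < \<bar>f y\<bar>"
    using isCont_less_on_norm_ball[of x "\<lambda>y. \<bar>f y\<bar>" e] assms isCont_rabs by blast
  then have "ball_average N x r (\<lambda>_. ennreal e) \<le> ball_average N x r (\<lambda>y. ennreal \<bar>f y\<bar>)"
    by (intro ball_average_mono ennreal_leI) (auto intro: less_imp_le)
  also have "\<dots> \<le> maximal N f x" using r by (intro ball_average_le_maximal) auto
  finally show "z \<le> maximal N f x" using r e by (simp add: ball_average_const)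
qed

lemma borel_measurable_radial:
  assumes "mono_on {0..} \<phi>" "t \<ge> 0"
  shows "(\<lambda>u. \<phi> (t * N (c + r *\<^sub>R u)) :: ennreal) \<in> borel_measurable lebesgue"
proof (rule borel_measurable_mono_on_comp[OF assms(1)])
  have "continuous_on UNIV (\<lambda>u. t * N (c + r *\<^sub>R u))"
    by (intro continuous_intros continuous_on_compose2[OF continuous_on_N[of UNIV]]) auto
  then show "(\<lambda>u. t * N (c + r *\<^sub>R u)) \<in> borel_measurable lebesgue"
    by (intro measurable_completion) (simp add: borel_measurable_continuous_onI)
qed (use assms in auto)

lemma scaled_average_eq_ball_average:
  assumes "mono_on {0..} \<phi>" "t \<ge> 0" "R > 0"
  shows "scaled_average N \<phi> t c R = ball_average N c R (\<lambda>y. \<phi> (t * N y))"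
  using ball_average_affine[of "\<lambda>y. \<phi> (t * N y)" R c] borel_measurable_radial[OF assms(1,2), of 0 1] assms
  by (simp add: scaled_average_def)

subsection \<open>The upper bound\<close>

lemma modulus_real_triangle:
  assumes "N (x - y) \<le> s" "\<And>x. g x \<ge> 0"
  shows "ennreal (g x) \<le> ennreal (g y) + modulus_real N g s"
proof -
  have "ext_dist (ereal (g x)) (ereal (g y)) \<le> modulus_real N g s"
    unfolding modulus_def by (rule SUP_upper2[of "(x, y)"]) (use assms in auto)
  then have "ennreal \<bar>g x - g y\<bar> \<le> modulus_real N g s" by (simp add: ext_dist_real)
  then have "ennreal (g y) + ennreal \<bar>g x - g y\<bar> \<le> ennreal (g y) + modulus_real N g s"
    by (intro add_left_mono)
  moreover have "ennreal (g x) \<le> ennreal (g y) + ennreal \<bar>g x - g y\<bar>"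
    using assms(2) by (simp add: ennreal_plus[symmetric] ennreal_leI del: ennreal_plus)
  ultimately show ?thesis by (rule order_trans[rotated])
qed

text \<open>Both balls are parametrised by \<open>- u\<close>, so that corresponding points differ by \<open>s (c + R u)\<close>.\<close>

lemma maximal_le_translate:
  assumes f: "f \<in> borel_measurable lebesgue" and s: "0 \<le> s" "s \<le> t"
    and adm: "(c, R) \<in> admissible N v"
  shows "maximal N f x \<le> maximal N f (x - s *\<^sub>R v) + scaled_average N (modulus_real N (\<lambda>x. \<bar>f x\<bar>)) t c R"
proof (rule maximal_leI)
  fix a r assume r: "r > 0" "N (x - a) \<le> r"
  let ?F = "\<lambda>y. ennreal \<bar>f y\<bar>" and ?\<omega> = "modulus_real N (\<lambda>x. \<bar>f x\<bar>)"
  define a' r' where "a' = a - s *\<^sub>R c" and "r' = r + s * R"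
  have R: "R > 0" "N (v - c) \<le> R" using adm by (auto simp: admissible_def)
  have r': "r' > 0" using r s R by (simp add: r'_def add_pos_nonneg)
  have mono: "mono_on {0..} ?\<omega>" by (intro mono_onI modulus_mono)
  have F: "?F \<in> borel_measurable lebesgue" using f by simp
  \<comment> \<open>The shift by \<open>s v\<close> is absorbed by moving the centre by
    \<open>s c\<close> and enlarging the radius by \<open>s R\<close>, which suffices because
    \<open>N (v - c) \<le> R\<close>.\<close>
  have in_ball: "N (x - s *\<^sub>R v - a') \<le> r'"
  proof -
    have "x - s *\<^sub>R v - a' = (x - a) + (- s) *\<^sub>R (v - c)" by (simp add: a'_def algebra_simps)
    then have "N (x - s *\<^sub>R v - a') \<le> N (x - a) + N ((- s) *\<^sub>R (v - c))" by (simp only: N_triangle)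
    also have "\<dots> \<le> r + s * R" using r R s by (simp add: add_mono mult_left_mono)
    finally show ?thesis by (simp add: r'_def)
  qed
  have pt: "?F (a + (- r) *\<^sub>R u) \<le> ?F (a' + (- r') *\<^sub>R u) + ?\<omega> (t * N (c + R *\<^sub>R u))" for u
  proof (rule modulus_real_triangle)
    have "a + (- r) *\<^sub>R u - (a' + (- r') *\<^sub>R u) = s *\<^sub>R (c + R *\<^sub>R u)"
      by (simp add: a'_def r'_def algebra_simps)
    then show "N (a + (- r) *\<^sub>R u - (a' + (- r') *\<^sub>R u)) \<le> t * N (c + R *\<^sub>R u)"
      using s by (simp add: mult_right_mono)
  qed simp
  have meas: "(\<lambda>u. ?F (a' + (- r') *\<^sub>R u)) \<in> borel_measurable lebesgue"
    using measurable_compose[OF measurable_affine_lebesgue[of "- r'" a'] F] r' by simp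
  have "ball_average N a r ?F = ball_average N 0 1 (\<lambda>u. ?F (a + (- r) *\<^sub>R u))"
    using ball_average_affine[OF F, of "- r" a] r by simp
  also have "\<dots> \<le> ball_average N 0 1 (\<lambda>u. ?F (a' + (- r') *\<^sub>R u) + ?\<omega> (t * N (c + R *\<^sub>R u)))"
    by (intro ball_average_mono pt)
  also have "\<dots> = ball_average N 0 1 (\<lambda>u. ?F (a' + (- r') *\<^sub>R u)) + scaled_average N ?\<omega> t c R"
    unfolding scaled_average_def using s
    by (intro ball_average_add meas borel_measurable_radial mono) auto
  also have "ball_average N 0 1 (\<lambda>u. ?F (a' + (- r') *\<^sub>R u)) = ball_average N a' r' ?F"
    using ball_average_affine[OF F, of "- r'" a'] r' by simp
  also have "\<dots> \<le> maximal N f (x - s *\<^sub>R v)"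
    using r' in_ball by (intro ball_average_le_maximal)
  finally show "ball_average N a r ?F \<le> maximal N f (x - s *\<^sub>R v) + scaled_average N ?\<omega> t c R"
    by (simp add: add_right_mono)
qed

text \<open>Two distinct points differ by a translation along one unit direction \<open>v\<close>.
  The infimum over balls may be taken for this \<open>v\<close>, and the supremum over directions
  removes the dependence on it. Equal points have no direction, hence the case split.\<close>

lemma maximal_le_add_modulus_bound:
  assumes f: "f \<in> borel_measurable lebesgue" and xy: "N (x - y) \<le> t"
  shows "maximal N f x \<le> maximal N f y + modulus_bound N (modulus_real N (\<lambda>x. \<bar>f x\<bar>)) t"
proof (cases "x = y")
  case False
  let ?\<omega> = "modulus_real N (\<lambda>x. \<bar>f x\<bar>)"
  define s where "s = N (x - y)"
  define v where "v = (1 / s) *\<^sub>R (x - y)"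
  have s: "s > 0" using False by (simp add: s_def order_less_le)
  have v: "N v = 1" "y = x - s *\<^sub>R v" using s by (auto simp: v_def s_def)
  have "maximal N f x \<le> maximal N f y + (INF (c, R) \<in> admissible N v. scaled_average N ?\<omega> t c R)"
    using maximal_le_translate[OF f, of s t _ _ v x] s xy
    unfolding v(2)[symmetric] s_def[symmetric] by (intro le_add_INF_ennreal) auto
  also have "\<dots> \<le> maximal N f y + modulus_bound N ?\<omega> t"
    unfolding modulus_bound_def using v by (intro add_left_mono SUP_upper2[of v]) auto
  finally show ?thesis .
qed simp

text \<open>\<open>f\<close> is the pointwise limit of its integrable restrictions to the balls
  \<open>cball 0 i\<close>.\<close>

lemma borel_measurable_locally_integrable:
  fixes f :: "real ^ 'n \<Rightarrow> real"
  assumes "locally_integrable f"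
  shows "f \<in> borel_measurable lebesgue"
proof -
  have "(\<lambda>x. indicator (cball 0 (real i)) x *\<^sub>R f x) \<in> borel_measurable lebesgue" for i
    using assms unfolding locally_integrable_def set_integrable_def
    by (intro borel_measurable_integrable) auto
  moreover have "(\<lambda>i. indicator (cball 0 (real i)) x *\<^sub>R f x) \<longlonglongrightarrow> f x" for x :: "real ^ 'n"
  proof (rule tendsto_eventually)
    have "\<forall>\<^sub>F i in sequentially. norm x \<le> real i"
      using filterlim_real_sequentially by (auto simp: filterlim_at_top)
    then show "\<forall>\<^sub>F i in sequentially. indicator (cball 0 (real i)) x *\<^sub>R f x = f x"
      by eventually_elim simp
  qed
  ultimately show ?thesis by (rule borel_measurable_LIMSEQ_real[of lebesgue "\<lambda>i x. indicator (cball 0 (real i)) x *\<^sub>R f x" f, rotated])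
qed

lemma modulus_maximal_le:
  assumes "f \<in> borel_measurable lebesgue"
  shows "modulus_maximal N f t \<le> modulus_bound N (modulus_real N (\<lambda>x. \<bar>f x\<bar>)) t"
  unfolding modulus_def[of N "\<lambda>x. enn2ereal (maximal N f x)"]
proof (rule SUP_least, clarsimp)
  fix x y assume "N (x - y) \<le> t"
  then show "ext_dist (enn2ereal (maximal N f x)) (enn2ereal (maximal N f y))
      \<le> modulus_bound N (modulus_real N (\<lambda>x. \<bar>f x\<bar>)) t"
    using assms N_minus_commute by (intro ext_dist_leI maximal_le_add_modulus_bound) auto
qed

subsection \<open>Reduction to small balls\<close>

text \<open>The two balls have equal volume, so \<open>A - B\<close> and \<open>B - A\<close> have
  equal measure. The radial integrand is at least \<open>\<phi> (t * R)\<close> on the former and at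
  most that on the latter.\<close>

lemma ball_average_radial_center_le:
  assumes \<phi>: "mono_on {0..} \<phi>" and "t \<ge> 0" "R > 0"
  shows "ball_average N 0 R (\<lambda>y. \<phi> (t * N y)) \<le> ball_average N c R (\<lambda>y. \<phi> (t * N y))"
proof -
  define A B where "A = norm_ball N c R" and "B = norm_ball N 0 R"
  define g where "g y = \<phi> (t * N y)" for y
  have [measurable]: "A \<in> sets lebesgue" "B \<in> sets lebesgue" by (auto simp: A_def B_def)
  have [measurable]: "g \<in> borel_measurable lebesgue"
    using borel_measurable_radial[OF assms(1,2), of 0 1] by (simp add: g_def[abs_def])
  have eq: "emeasure lebesgue A = emeasure lebesgue B"
    unfolding A_def B_def using emeasure_norm_ball[OF assms(3)] by metis
  have split: "emeasure lebesgue X = emeasure lebesgue (X \<inter> Y) + emeasure lebesgue (X - Y)"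
    if [measurable]: "X \<in> sets lebesgue" "Y \<in> sets lebesgue" for X Y :: "(real ^ 'n) set"
    using plus_emeasure[of "X \<inter> Y" lebesgue "X - Y"] by (simp add: Int_Diff_disjoint Int_Diff_Un)
  \<comment> \<open>Cancelling the measure of the common part in \<open>ennreal\<close> requires it
    to be finite.\<close>
  have fin: "emeasure lebesgue (A \<inter> B) \<noteq> top"
    using emeasure_mono[of "A \<inter> B" A lebesgue] emeasure_norm_ball_finite[of c R]
    by (auto simp: A_def top_unique)
  have diff: "emeasure lebesgue (A - B) = emeasure lebesgue (B - A)"
    using eq split[of A B] split[of B A] fin by (simp add: ennreal_add_left_cancel Int_commute)
  have pw: "g y * indicator B y \<le> g y * indicator (A \<inter> B) y + \<phi> (t * R) * indicator (B - A) y"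
    "g y * indicator (A \<inter> B) y + \<phi> (t * R) * indicator (A - B) y \<le> g y * indicator A y" for y
    using assms by (auto simp: indicator_def B_def mem_norm_ball g_def mult_left_mono intro!: mono_onD[OF \<phi>])
  have "(\<integral>\<^sup>+ y. g y * indicator B y \<partial>lebesgue)
      \<le> (\<integral>\<^sup>+ y. g y * indicator (A \<inter> B) y + \<phi> (t * R) * indicator (B - A) y \<partial>lebesgue)"
    by (intro nn_integral_mono pw)
  also have "\<dots> = (\<integral>\<^sup>+ y. g y * indicator (A \<inter> B) y + \<phi> (t * R) * indicator (A - B) y \<partial>lebesgue)"
    by (simp add: nn_integral_add nn_integral_cmult_indicator diff)
  also have "\<dots> \<le> (\<integral>\<^sup>+ y. g y * indicator A y \<partial>lebesgue)"
    by (intro nn_integral_mono pw)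
  finally show ?thesis
    unfolding ball_average_def eq[unfolded A_def B_def]
    by (intro divide_right_mono_ennreal) (simp add: A_def B_def g_def)
qed

lemma admissible_small_le:
  assumes \<phi>: "mono_on {0..} \<phi>" and t: "t \<ge> 0" and v: "N v = 1" and adm: "(c, R) \<in> admissible N v"
  obtains c' R' where "(c', R') \<in> admissible_small N v"
    "scaled_average N \<phi> t c' R' \<le> scaled_average N \<phi> t c R"
proof (cases "R \<ge> 1")
  case True
  \<comment> \<open>The replacement is the unit ball around \<open>0\<close>: the radius shrinks
    from \<open>R\<close> to \<open>1\<close> about the centre \<open>0\<close>, and the centres
    \<open>0\<close> and \<open>c\<close> are compared at equal radius \<open>R\<close>.\<close>
  have "t * N u \<le> t * (R * N u)" for u
    using mult_right_mono[OF True N_nonneg] t by (simp add: mult_left_mono)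
  then have "scaled_average N \<phi> t 0 1 \<le> scaled_average N \<phi> t 0 R"
    unfolding scaled_average_def using True t
    by (intro ball_average_mono mono_onD[OF \<phi>]) auto
  also have "\<dots> \<le> scaled_average N \<phi> t c R"
    using True t \<phi> by (simp add: scaled_average_eq_ball_average ball_average_radial_center_le)
  finally show ?thesis using v by (intro that[of 0 1]) (auto simp: admissible_small_def)
next
  case False
  have R: "R > 0" "N (v - c) \<le> R" using adm by (auto simp: admissible_def)
  \<comment> \<open>For this \<open>l\<close> the point \<open>l v\<close> is no longer inside the
    ball, so the ray from \<open>v\<close> meets the boundary at some \<open>\<mu> v\<close> with
    \<open>\<mu> \<ge> 1\<close>. Dividing the ball by \<open>\<mu>\<close> puts \<open>v\<close> on
    its boundary and brings all its points closer to \<open>0\<close>.\<close>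
  define l where "l = R + N c + 1"
  have "\<exists>\<mu>\<ge>1. \<mu> \<le> l \<and> N (\<mu> *\<^sub>R v - c) = R"
  proof (rule IVT')
    show "continuous_on {1..l} (\<lambda>\<mu>. N (\<mu> *\<^sub>R v - c))"
      by (intro continuous_on_compose2[OF continuous_on_N[of UNIV]] continuous_intros) auto
    have "N (l *\<^sub>R v) \<le> N (l *\<^sub>R v - c) + N c"
      using N_triangle[of "l *\<^sub>R v - c" c] by simp
    moreover have "l > 0" using R by (simp add: l_def add_pos_nonneg add_nonneg_pos)
    ultimately show "R \<le> N (l *\<^sub>R v - c)" using R v by (simp add: l_def)
  qed (use R in \<open>auto simp: l_def\<close>)
  then obtain \<mu> where \<mu>: "\<mu> \<ge> 1" "N (\<mu> *\<^sub>R v - c) = R" by blast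
  define c' R' where "c' = (1 / \<mu>) *\<^sub>R c" and "R' = R / \<mu>"
  have scale: "N (x /\<^sub>R \<mu>) = N x / \<mu>" for x using \<mu> by (simp add: divide_inverse)
  have "v - c' = (\<mu> *\<^sub>R v - c) /\<^sub>R \<mu>" using \<mu> by (simp add: c'_def algebra_simps divide_inverse)
  then have "N (v - c') = R'" using \<mu>(2) scale[of "\<mu> *\<^sub>R v - c"] by (simp only: R'_def)
  moreover have "R' > 0" "R' \<le> 1" using R False \<mu> by (auto simp: R'_def field_simps)
  moreover have "scaled_average N \<phi> t c' R' \<le> scaled_average N \<phi> t c R"
    unfolding scaled_average_def
  proof (intro ball_average_mono mono_onD[OF \<phi>])
    fix u :: "real ^ 'n"
    have "c' + R' *\<^sub>R u = (c + R *\<^sub>R u) /\<^sub>R \<mu>" by (simp add: c'_def R'_def algebra_simps divide_inverse)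
    then have "N (c' + R' *\<^sub>R u) = N (c + R *\<^sub>R u) / \<mu>" by (simp only: scale)
    also have "\<dots> \<le> N (c + R *\<^sub>R u)"
      using \<mu>(1) mult_left_mono[OF \<mu>(1) N_nonneg, of "c + R *\<^sub>R u"] by (simp add: divide_le_eq)
    finally show "t * N (c' + R' *\<^sub>R u) \<le> t * N (c + R *\<^sub>R u)" using t by (rule mult_left_mono)
  qed (use t in auto)
  ultimately show ?thesis by (intro that[of c' R']) (auto simp: admissible_small_def)
qed

lemma INF_admissible_small:
  assumes "mono_on {0..} \<phi>" "t \<ge> 0" "N v = 1"
  shows "(INF (c, R) \<in> admissible_small N v. scaled_average N \<phi> t c R)
       = (INF (c, R) \<in> admissible N v. scaled_average N \<phi> t c R)"
proof (rule antisym)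
  show "(INF (c, R) \<in> admissible_small N v. scaled_average N \<phi> t c R)
      \<le> (INF (c, R) \<in> admissible N v. scaled_average N \<phi> t c R)"
  proof (rule INF_mono)
    fix p assume "p \<in> admissible N v"
    then obtain c R where p: "p = (c, R)" "(c, R) \<in> admissible N v" by (cases p) auto
    obtain c' R' where "(c', R') \<in> admissible_small N v"
      "scaled_average N \<phi> t c' R' \<le> scaled_average N \<phi> t c R"
      by (rule admissible_small_le[OF assms p(2)])
    then show "\<exists>q\<in>admissible_small N v. (case q of (c, R) \<Rightarrow> scaled_average N \<phi> t c R)
        \<le> (case p of (c, R) \<Rightarrow> scaled_average N \<phi> t c R)"
      using p by (intro bexI[of _ "(c', R')"]) auto
  qed
  show "(INF (c, R) \<in> admissible N v. scaled_average N \<phi> t c R)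
      \<le> (INF (c, R) \<in> admissible_small N v. scaled_average N \<phi> t c R)"
    by (rule INF_superset_mono) (auto simp: admissible_def admissible_small_def)
qed

subsection \<open>Strict growth of the maximal function\<close>

text \<open>As \<open>f\<close> is bounded with bounded support, nearly optimal balls for
  \<open>f\<close> at \<open>x\<close> have bounded radius. Each of them contains a ball near
  \<open>x\<close> that occupies a fixed fraction of its volume and on which \<open>g\<close> is at
  least \<open>g x / 2\<close>. Adding \<open>g\<close> thus raises every nearly optimal average by
  a fixed \<open>\<eta>\<close>.\<close>

lemma maximal_less_maximal_add:
  fixes f g :: "real ^ 'n \<Rightarrow> real"
  assumes cont: "continuous_on UNIV f" "continuous_on UNIV g"
    and nonneg: "\<And>y. f y \<ge> 0" "\<And>y. g y \<ge> 0" and f_le: "\<And>y. f y \<le> h"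
    and supp: "\<And>y. y \<notin> norm_ball N z \<rho> \<Longrightarrow> f y = 0" and \<rho>: "\<rho> > 0"
    and pos: "f x > 0" "g x > 0"
  shows "maximal N f x < maximal N (\<lambda>y. f y + g y) x"
proof (rule ccontr)
  assume "\<not> ?thesis"
  then have le: "maximal N (\<lambda>y. f y + g y) x \<le> maximal N f x" by simp
  have isCont: "isCont f x" "isCont g x" using cont by (auto simp: continuous_on_eq_continuous_at)
  have meas: "(\<lambda>y. ennreal \<bar>f y\<bar>) \<in> borel_measurable lebesgue" "(\<lambda>y. ennreal \<bar>g y\<bar>) \<in> borel_measurable lebesgue"
    using cont by (auto intro!: measurable_completion borel_measurable_continuous_onI continuous_intros
        measurable_compose[OF _ measurable_ennreal])
  have h: "h > 0" using f_le[of x] pos by simp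
  have "maximal N f x \<le> ennreal h" using nonneg f_le by (intro maximal_le_bound) simp
  then obtain A where A: "maximal N f x = ennreal A" "A \<ge> 0"
    by (metis ennreal_less_top le_less_trans less_top_ennreal)
  have "ennreal (f x) \<le> ennreal A" using abs_le_maximal[OF isCont(1)] nonneg A by simp
  then have A_ge: "A \<ge> f x" using A by simp
  obtain \<delta> where \<delta>: "\<delta> > 0" "\<And>y. y \<in> norm_ball N x \<delta> \<Longrightarrow> g x / 2 < g y"
    using isCont_less_on_norm_ball[OF isCont(2), of "g x / 2"] pos by auto
  \<comment> \<open>Chosen so that balls of radius above \<open>R\<close> have averages of
    \<open>f\<close> at most \<open>h * (\<rho> / R) \<le> f x / 4\<close>.\<close>
  define R where "R = \<rho> * (1 + 4 * h / f x)"
  have R: "R > 0" using \<rho> h pos by (simp add: R_def add_pos_nonneg)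
  \<comment> \<open>The first term keeps \<open>A - \<eta>\<close> at least \<open>f x / 2\<close>,
    too much for a ball of radius above \<open>R\<close>; the second is the gain guaranteed by
    \<open>g\<close> on all smaller balls.\<close>
  define \<eta> where "\<eta> = min (f x / 2) (g x / 2 * min 1 (\<delta> / (2 * R)) ^ CARD('n))"
  have \<eta>: "\<eta> > 0" "\<eta> \<le> f x / 2" using pos \<delta> R by (auto simp: \<eta>_def)
  have "ennreal (A - \<eta>) < maximal N f x" using A_ge \<eta> pos by (simp add: A ennreal_less_iff)
  then obtain c r where r: "r > 0" "N (x - c) \<le> r"
    and large: "ennreal (A - \<eta>) < ball_average N c r (\<lambda>y. ennreal \<bar>f y\<bar>)"
    unfolding maximal_def less_SUP_iff by (auto simp: mem_norm_ball)
  have "r \<le> R"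
  proof (rule ccontr)
    assume "\<not> r \<le> R"
    have "R \<ge> \<rho>" using \<rho> h pos by (simp add: R_def)
    have "ball_average N c r (\<lambda>y. ennreal \<bar>f y\<bar>) \<le> ennreal (h * (\<rho> / r) ^ CARD('n))"
      using \<rho> r h nonneg f_le supp by (intro ball_average_le_support) (auto intro!: ennreal_leI)
    also have "h * (\<rho> / r) ^ CARD('n) \<le> h * (\<rho> / R)"
    proof (rule mult_left_mono)
      have "(\<rho> / r) ^ CARD('n) \<le> (\<rho> / r) ^ 1"
        using \<open>R \<ge> \<rho>\<close> \<open>\<not> r \<le> R\<close> \<rho> r by (intro power_decreasing) (auto simp: Suc_leI)
      also have "\<dots> \<le> \<rho> / R" using R \<rho> \<open>\<not> r \<le> R\<close> by (simp add: frac_le)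
      finally show "(\<rho> / r) ^ CARD('n) \<le> \<rho> / R" .
    qed (use h in simp)
    also have "h * (\<rho> / R) \<le> f x / 4"
      using \<rho> h pos by (simp add: R_def divide_simps add_pos_pos)
    finally have "ball_average N c r (\<lambda>y. ennreal \<bar>f y\<bar>) \<le> ennreal (f x / 4)"
      by (simp add: ennreal_leI)
    then have "ennreal (A - \<eta>) < ennreal (f x / 4)" using large by (rule less_le_trans[rotated])
    then show False using A_ge \<eta> pos by (simp add: ennreal_less_iff)
  qed
  \<comment> \<open>The image of the ball under the homothety with centre \<open>x\<close> and ratio
    \<open>r' / r\<close>: it stays inside the ball because \<open>x\<close> lies there, and within
    distance \<open>2 * r' \<le> \<delta>\<close> of \<open>x\<close>.\<close>
  define r' c' where "r' = min r (\<delta> / 2)" and "c' = x + (r' / r) *\<^sub>R (c - x)"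
  have r': "r' > 0" "r' \<le> r" "2 * r' \<le> \<delta>" using r \<delta> by (auto simp: r'_def)
  have sub: "norm_ball N c' r' \<subseteq> norm_ball N c r" "norm_ball N c' r' \<subseteq> norm_ball N x \<delta>"
  proof -
    have "N (y - c) \<le> r \<and> N (y - x) \<le> \<delta>" if y: "N (y - c') \<le> r'" for y
    proof
      have "c' - c = (1 - r' / r) *\<^sub>R (x - c)" using r by (simp add: c'_def algebra_simps)
      then have "N (c' - c) = (1 - r' / r) * N (x - c)" using r r' by simp
      also have "\<dots> \<le> (1 - r' / r) * r" using r r' by (intro mult_left_mono) auto
      also have "\<dots> = r - r'" using r by (simp add: field_simps)
      finally show "N (y - c) \<le> r" using N_triangle[of "y - c'" "c' - c"] y by simp
      have "N (c' - x) = (r' / r) * N (x - c)"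
        using r r' N_minus_commute[of c x] by (simp add: c'_def)
      also have "\<dots> \<le> (r' / r) * r" using r r' by (intro mult_left_mono) auto
      finally show "N (y - x) \<le> \<delta>" using N_triangle[of "y - c'" "c' - x"] y r r' by simp
    qed
    then show "norm_ball N c' r' \<subseteq> norm_ball N c r" "norm_ball N c' r' \<subseteq> norm_ball N x \<delta>"
      by (auto simp: mem_norm_ball)
  qed
  have "min 1 (\<delta> / (2 * R)) \<le> r' / r"
  proof -
    have "\<delta> / (2 * R) \<le> \<delta> / (2 * r)" using \<open>r \<le> R\<close> \<delta> r by (intro divide_left_mono) auto
    then show ?thesis using r by (auto simp: r'_def min_def divide_simps)
  qed
  then have "\<eta> \<le> g x / 2 * (r' / r) ^ CARD('n)"
    using \<delta> R pos unfolding \<eta>_def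
    by (intro min.coboundedI2[OF mult_left_mono[OF power_mono]]) auto
  then have "ennreal \<eta> \<le> ennreal (g x / 2 * (r' / r) ^ CARD('n))" by (rule ennreal_leI)
  also have "\<dots> \<le> ball_average N c r (\<lambda>y. ennreal \<bar>g y\<bar>)"
    using sub r r' pos \<delta>(2) nonneg
    by (intro ball_average_ge_subball ennreal_leI) (auto intro: less_imp_le dest!: subsetD)
  finally have "ball_average N c r (\<lambda>y. ennreal \<bar>f y\<bar>) + ennreal \<eta>
      \<le> ball_average N c r (\<lambda>y. ennreal \<bar>f y\<bar>) + ball_average N c r (\<lambda>y. ennreal \<bar>g y\<bar>)"
    by (rule add_left_mono)
  also have "\<dots> = ball_average N c r (\<lambda>y. ennreal \<bar>f y + g y\<bar>)"
    unfolding ball_average_add[OF meas, symmetric] using nonneg by simp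
  also have "\<dots> \<le> ennreal A"
    using ball_average_le_maximal[OF r] le A by (metis order_trans)
  finally have bd: "ball_average N c r (\<lambda>y. ennreal \<bar>f y\<bar>) + ennreal \<eta> \<le> ennreal A" .
  then have "ball_average N c r (\<lambda>y. ennreal \<bar>f y\<bar>) < top"
    by (auto simp: less_top[symmetric] top_unique)
  then obtain p where "p \<ge> 0" "ball_average N c r (\<lambda>y. ennreal \<bar>f y\<bar>) = ennreal p"
    by (metis less_top_ennreal)
  with bd large A \<eta> A_ge show False
    by (simp add: ennreal_plus[symmetric] ennreal_less_iff del: ennreal_plus)
qed

end

section \<open>Moduli of continuity and spikes\<close>

locale cart_norm_modulus = cart_norm N for N :: "real ^ 'n \<Rightarrow> real" +
  fixes \<omega> :: "real \<Rightarrow> real"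
  assumes is_modulus: "is_modulus \<omega>"
begin

lemma \<omega>_mono: "0 \<le> s \<Longrightarrow> s \<le> t \<Longrightarrow> \<omega> s \<le> \<omega> t"
  and \<omega>_add_le: "0 \<le> s \<Longrightarrow> 0 \<le> t \<Longrightarrow> \<omega> (s + t) \<le> \<omega> s + \<omega> t"
  and \<omega>_zero [simp]: "\<omega> 0 = 0"
  and continuous_on_\<omega>: "continuous_on {0..} \<omega>"
  using is_modulus by (auto simp: is_modulus_def mono_on_def)

lemma \<omega>_nonneg: "t \<ge> 0 \<Longrightarrow> \<omega> t \<ge> 0"
  using \<omega>_mono[of 0 t] by simp

lemma \<omega>_N_diff: "\<bar>\<omega> (N x) - \<omega> (N y)\<bar> \<le> \<omega> (N (x - y))"
proof -
  have *: "\<omega> (N x) \<le> \<omega> (N y) + \<omega> (N (x - y))" for x y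
  proof -
    have "\<omega> (N x) \<le> \<omega> (N y + N (x - y))"
      using N_triangle[of y "x - y"] by (intro \<omega>_mono) auto
    also have "\<dots> \<le> \<omega> (N y) + \<omega> (N (x - y))" by (intro \<omega>_add_le) auto
    finally show ?thesis .
  qed
  show ?thesis using *[of x y] *[of y x] by (simp add: N_minus_commute[of y x] abs_le_iff)
qed

lemma spike_nonneg: "spike N \<omega> h a x \<ge> 0"
  by (simp add: spike_def)

lemma spike_le: "h \<ge> 0 \<Longrightarrow> spike N \<omega> h a x \<le> h"
  using \<omega>_nonneg[of "N (x - a)"] by (simp add: spike_def)

lemma spike_diff: "\<bar>spike N \<omega> h a x - spike N \<omega> h a y\<bar> \<le> \<omega> (N (x - y))"
  using \<omega>_N_diff[of "x - a" "y - a"] by (simp add: spike_def max_def abs_le_iff)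

lemma small_\<omega>:
  assumes "e > 0"
  obtains d where "d > 0" "\<And>s. 0 \<le> s \<Longrightarrow> s \<le> d \<Longrightarrow> \<omega> s < e"
proof -
  obtain d where "d > 0" "\<forall>s\<in>{0..}. dist s 0 < d \<longrightarrow> dist (\<omega> s) (\<omega> 0) < e"
    using continuous_on_\<omega>[unfolded continuous_on_iff, rule_format, of 0 e] assms by auto
  then show ?thesis using that[of "d / 2"] by (auto simp: dist_real_def abs_less_iff)
qed

lemma continuous_on_of_modulus:
  fixes g :: "real ^ 'n \<Rightarrow> real"
  assumes "\<And>x y. \<bar>g x - g y\<bar> \<le> \<omega> (N (x - y))"
  shows "continuous_on S g"
  unfolding continuous_on_iff
proof (intro ballI allI impI)
  fix x and e :: real assume "e > 0"
  then obtain d where d: "d > 0" "\<And>s. 0 \<le> s \<Longrightarrow> s \<le> d \<Longrightarrow> \<omega> s < e" by (rule small_\<omega>) blast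
  obtain C where C: "C > 0" "\<forall>x. N x \<le> C * norm x" by (rule is_norm_le_norm[OF is_norm])
  show "\<exists>d>0. \<forall>y\<in>S. dist y x < d \<longrightarrow> dist (g y) (g x) < e"
  proof (intro exI[of _ "d / C"] conjI ballI impI)
    fix y :: "real ^ 'n" assume "dist y x < d / C"
    then have "C * norm (y - x) < d" using C by (simp add: dist_norm field_simps)
    then have "N (y - x) \<le> d" using C(2)[rule_format, of "y - x"] by simp
    then show "dist (g y) (g x) < e"
      using assms[of y x] d(2)[of "N (y - x)"] by (simp add: dist_real_def)
  qed (use C d in simp)
qed

lemma continuous_on_spike: "continuous_on S (spike N \<omega> h a)"
  by (rule continuous_on_of_modulus[OF spike_diff])

lemma borel_measurable_continuous_lebesgue:
  fixes g :: "real ^ 'n \<Rightarrow> real"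
  shows "continuous_on UNIV g \<Longrightarrow> g \<in> borel_measurable lebesgue"
  by (intro measurable_completion) (simp add: borel_measurable_continuous_onI)

lemma mono_on_min_\<omega>: "mono_on {0..} (\<lambda>s. ennreal (min h (\<omega> s)))"
  by (intro mono_onI ennreal_leI min.mono \<omega>_mono) auto

lemma mono_on_\<omega>: "mono_on {0..} (\<lambda>s. ennreal (\<omega> s))"
  by (intro mono_onI ennreal_leI \<omega>_mono) auto

lemma modulus_real_le:
  assumes "\<And>x y. \<bar>g x - g y\<bar> \<le> \<omega> (N (x - y))"
  shows "modulus_real N g t \<le> ennreal (\<omega> t)"
  unfolding modulus_def
proof (rule SUP_least, clarsimp simp: ext_dist_real)
  fix x y assume "N (x - y) \<le> t"
  then show "ennreal \<bar>g x - g y\<bar> \<le> ennreal (\<omega> t)"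
    using assms[of x y] \<omega>_mono[of "N (x - y)" t] by (intro ennreal_leI) simp
qed

subsection \<open>Extremal functions\<close>

text \<open>The averages of a spike and of the truncated modulus over the same ball add up to \<open>h\<close>.\<close>

lemma maximal_spike_add_INF_le:
  assumes h: "h \<ge> 0" and t: "t > 0"
  shows "maximal N (spike N \<omega> h a) (a + t *\<^sub>R v)
    + (INF (c, R) \<in> admissible N v. scaled_average N (\<lambda>s. ennreal (min h (\<omega> s))) t c R) \<le> ennreal h"
    (is "?M + ?I \<le> _")
proof -
  \<comment> \<open>Moving the summand \<open>?I\<close> inside the supremum requires a nonempty
    index set.\<close>
  have ne: "{(c, r). r > 0 \<and> a + t *\<^sub>R v \<in> norm_ball N c r} \<noteq> {}"
    by (auto simp: mem_norm_ball intro!: exI[of _ "a + t *\<^sub>R v"] exI[of _ "1 :: real"])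
  have "ball_average N c r (\<lambda>y. ennreal \<bar>spike N \<omega> h a y\<bar>) + ?I \<le> ennreal h"
    if r: "r > 0" "N (a + t *\<^sub>R v - c) \<le> r" for c r
  proof -
    let ?F = "\<lambda>y. ennreal \<bar>spike N \<omega> h a y\<bar>"
    \<comment> \<open>The rescaling that sends the peak \<open>a\<close> to \<open>0\<close> and
      \<open>a + t v\<close> to \<open>v\<close>; balls containing \<open>a + t v\<close> become
      admissible ones.\<close>
    define c' R where "c' = (c - a) /\<^sub>R t" and "R = r / t"
    have F: "?F \<in> borel_measurable lebesgue"
      using borel_measurable_continuous_lebesgue[OF continuous_on_spike] by measurable
    have "v - c' = (a + t *\<^sub>R v - c) /\<^sub>R t" using t by (simp add: c'_def algebra_simps)
    then have "N (v - c') = N (a + t *\<^sub>R v - c) / t" using t by (simp add: divide_inverse)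
    also have "\<dots> \<le> R" using r t by (simp add: R_def divide_right_mono)
    finally have "(c', R) \<in> admissible N v" using r t by (simp add: admissible_def R_def)
    then have "?I \<le> scaled_average N (\<lambda>s. ennreal (min h (\<omega> s))) t c' R"
      by (intro INF_lower2) auto
    moreover have "ball_average N c r ?F + scaled_average N (\<lambda>s. ennreal (min h (\<omega> s))) t c' R = ennreal h"
    proof -
      have "?F (c + r *\<^sub>R u) + ennreal (min h (\<omega> (t * N (c' + R *\<^sub>R u)))) = ennreal h" for u
      proof -
        have "c + r *\<^sub>R u - a = t *\<^sub>R (c' + R *\<^sub>R u)" using t by (simp add: c'_def R_def algebra_simps)
        then have "N (c + r *\<^sub>R u - a) = t * N (c' + R *\<^sub>R u)" using t by simp
        moreover have "\<omega> (t * N (c' + R *\<^sub>R u)) \<ge> 0" using t by (intro \<omega>_nonneg) simp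
        moreover have "max (h - p) 0 + min h p = h" for p by (simp add: max_def min_def)
        ultimately show ?thesis
          using h by (simp add: spike_def ennreal_plus[symmetric] del: ennreal_plus)
      qed
      then have "ball_average N 0 1 (\<lambda>u. ?F (c + r *\<^sub>R u) + ennreal (min h (\<omega> (t * N (c' + R *\<^sub>R u))))) = ennreal h"
        by (simp add: ball_average_const)
      moreover have "ball_average N c r ?F = ball_average N 0 1 (\<lambda>u. ?F (c + r *\<^sub>R u))"
        using ball_average_affine[OF F, of r c] r by simp
      moreover have "(\<lambda>u. ?F (c + r *\<^sub>R u)) \<in> borel_measurable lebesgue"
        using measurable_compose[OF measurable_affine_lebesgue[of r c] F] r by simp
      moreover have "(\<lambda>u. ennreal (min h (\<omega> (t * N (c' + R *\<^sub>R u))))) \<in> borel_measurable lebesgue"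
        using t by (intro borel_measurable_radial[OF mono_on_min_\<omega>]) simp
      ultimately show ?thesis by (simp add: scaled_average_def ball_average_add)
    qed
    ultimately show ?thesis by (metis add_left_mono)
  qed
  then show ?thesis
    unfolding maximal_def using ne
    by (subst ennreal_SUP_add_left[symmetric]) (auto intro!: SUP_least simp: mem_norm_ball)
qed

text \<open>The reduction to small balls applies to both integrands. On such balls
  \<open>N c \<le> 2\<close> and \<open>R * N u \<le> 1\<close>, so only arguments up to
  \<open>3 * t\<close> occur and the truncation is invisible.\<close>

lemma INF_admissible_min:
  assumes t: "t > 0" and v: "N v = 1" and h: "\<omega> (3 * t) \<le> h"
  shows "(INF (c, R) \<in> admissible N v. scaled_average N (\<lambda>s. ennreal (min h (\<omega> s))) t c R)
       = (INF (c, R) \<in> admissible N v. scaled_average N (\<lambda>s. ennreal (\<omega> s)) t c R)"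
proof -
  have "scaled_average N (\<lambda>s. ennreal (min h (\<omega> s))) t c R = scaled_average N (\<lambda>s. ennreal (\<omega> s)) t c R"
    if cR: "(c, R) \<in> admissible_small N v" for c R
    unfolding scaled_average_def
  proof (rule ball_average_cong)
    fix u assume u: "u \<in> norm_ball N 0 1"
    have R: "0 < R" "R \<le> 1" "N (v - c) = R" using cR by (auto simp: admissible_small_def)
    have "N c \<le> 1 + R" using N_triangle[of v "c - v"] R v by (simp add: N_minus_commute)
    moreover have "R * N u \<le> 1 * 1" using u R by (intro mult_mono) (auto simp: mem_norm_ball)
    ultimately have "N (c + R *\<^sub>R u) \<le> 3" using N_triangle[of c "R *\<^sub>R u"] R by simp
    then have "\<omega> (t * N (c + R *\<^sub>R u)) \<le> \<omega> (3 * t)" using t by (intro \<omega>_mono) auto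
    then show "ennreal (min h (\<omega> (t * N (c + R *\<^sub>R u)))) = ennreal (\<omega> (t * N (c + R *\<^sub>R u)))"
      using h by (simp add: min_absorb2)
  qed
  then have "(INF (c, R) \<in> admissible_small N v. scaled_average N (\<lambda>s. ennreal (min h (\<omega> s))) t c R)
       = (INF (c, R) \<in> admissible_small N v. scaled_average N (\<lambda>s. ennreal (\<omega> s)) t c R)"
    by (intro INF_cong) auto
  then show ?thesis
    using t v by (simp add: INF_admissible_small mono_on_min_\<omega> mono_on_\<omega>)
qed

text \<open>A criterion for both forms of \<open>\<psi>\<close>. The upper bounds are global
  consequences of \<open>diff\<close>. For equality at scale \<open>t\<close> one sufficiently high
  spike is enough: for every direction \<open>v\<close> the pair \<open>a\<close>,
  \<open>a + t v\<close> realises the infimum belonging to \<open>v\<close>.\<close>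

lemma extremalI:
  assumes nonneg: "\<And>x. \<psi> x \<ge> 0" and diff: "\<And>x y. \<bar>\<psi> x - \<psi> y\<bar> \<le> \<omega> (N (x - y))"
    and spike: "\<And>t. t > 0 \<Longrightarrow> \<exists>a h. \<omega> (3 * t) \<le> h \<and> (\<forall>x. N (x - a) \<le> t \<longrightarrow>
      \<psi> x = spike N \<omega> h a x \<and> maximal N \<psi> x = maximal N (spike N \<omega> h a) x)"
  shows "extremal N \<omega> \<psi>"
proof -
  \<comment> \<open>The value \<open>t = 0\<close> is included because the integrand of the bound is
    evaluated at \<open>t * N (c + R u)\<close>, which may vanish.\<close>
  have modulus: "modulus_real N \<psi> t = ennreal (\<omega> t)" if t: "t \<ge> 0" for t
  proof (rule antisym)
    show "ennreal (\<omega> t) \<le> modulus_real N \<psi> t"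
    proof (cases "t = 0")
      case False
      then have t: "t > 0" using t by simp
      obtain a h where h: "\<omega> (3 * t) \<le> h" and eq: "\<And>x. N (x - a) \<le> t \<Longrightarrow> \<psi> x = spike N \<omega> h a x"
        using spike[OF t] by blast
      obtain v where v: "N v = 1" by (rule is_norm_obtain_unit[OF is_norm])
      have "\<psi> a = h" "\<psi> (a + t *\<^sub>R v) = h - \<omega> t"
        using eq[of a] eq[of "a + t *\<^sub>R v"] t v h \<omega>_nonneg[of "3 * t"] \<omega>_mono[of t "3 * t"]
        by (auto simp: spike_def)
      then have "ennreal (\<omega> t) = ext_dist (ereal (\<psi> a)) (ereal (\<psi> (a + t *\<^sub>R v)))"
        using \<omega>_nonneg[of t] t by (simp add: ext_dist_real)
      also have "\<dots> \<le> modulus_real N \<psi> t"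
        unfolding modulus_def using t v by (intro SUP_upper2[of "(a, a + t *\<^sub>R v)"]) auto
      finally show ?thesis .
    qed simp
  qed (rule modulus_real_le[OF diff])
  have "modulus_maximal N \<psi> t = modulus_bound N (\<lambda>s. ennreal (\<omega> s)) t" if t: "t > 0" for t
  proof (rule antisym)
    have "modulus_bound N (modulus_real N (\<lambda>x. \<bar>\<psi> x\<bar>)) t = modulus_bound N (\<lambda>s. ennreal (\<omega> s)) t"
      using nonneg t by (simp add: modulus_bound_def scaled_average_def modulus)
    then show "modulus_maximal N \<psi> t \<le> modulus_bound N (\<lambda>s. ennreal (\<omega> s)) t"
      using modulus_maximal_le[OF borel_measurable_continuous_lebesgue[OF continuous_on_of_modulus[OF diff]]]
      by metis
    obtain a h where h: "\<omega> (3 * t) \<le> h" and eq: "\<And>x. N (x - a) \<le> t \<Longrightarrow>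
        \<psi> x = spike N \<omega> h a x \<and> maximal N \<psi> x = maximal N (spike N \<omega> h a) x"
      using spike[OF t] by blast
    have h0: "h \<ge> 0" using h \<omega>_nonneg[of "3 * t"] t by simp
    \<comment> \<open>Finiteness at the peak excludes the case of two infinite values, whose
      distance would be \<open>0\<close>.\<close>
    have peak: "ennreal h \<le> maximal N \<psi> a" "maximal N \<psi> a < top"
    proof -
      have "isCont \<psi> a" using continuous_on_of_modulus[OF diff, of UNIV] by (simp add: continuous_on_eq_continuous_at)
      then show "ennreal h \<le> maximal N \<psi> a"
        using abs_le_maximal[of a \<psi>] eq[of a] t h0 by (simp add: spike_def)
      have "maximal N (spike N \<omega> h a) a \<le> ennreal h"
        using h0 by (intro maximal_le_bound) (simp add: spike_nonneg spike_le)
      then show "maximal N \<psi> a < top" using eq[of a] t by (simp add: le_less_trans[OF _ ennreal_less_top])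
    qed
    show "modulus_bound N (\<lambda>s. ennreal (\<omega> s)) t \<le> modulus_maximal N \<psi> t"
      unfolding modulus_bound_def
    proof (rule SUP_least)
      fix v assume "v \<in> {v. N v = 1}"
      then have v: "N v = 1" by simp
      let ?I = "INF (c, R) \<in> admissible N v. scaled_average N (\<lambda>s. ennreal (\<omega> s)) t c R"
      have "maximal N \<psi> (a + t *\<^sub>R v) + ?I \<le> ennreal h"
        using maximal_spike_add_INF_le[OF h0 t, of a v] INF_admissible_min[OF t v h] eq[of "a + t *\<^sub>R v"] t v
        by simp
      then have "?I \<le> ext_dist (enn2ereal (maximal N \<psi> a)) (enn2ereal (maximal N \<psi> (a + t *\<^sub>R v)))"
        using peak by (intro ext_dist_geI) (auto intro: order_trans)
      also have "\<dots> \<le> modulus_maximal N \<psi> t"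
        unfolding modulus_def using t v by (intro SUP_upper2[of "(a, a + t *\<^sub>R v)"]) auto
      finally show "?I \<le> modulus_maximal N \<psi> t" .
    qed
  qed
  then show ?thesis using modulus by (simp add: extremal_def)
qed

section \<open>Bounded moduli: a single spike\<close>

text \<open>By monotonicity a value \<open>\<omega> t\<close> above the essential supremum would be
  matched or exceeded on all of \<open>{t..t+1}\<close>, a set of positive measure.\<close>

lemma \<omega>_le_Linfty_norm:
  assumes bdd: "bounded (\<omega> ` {0..})" and t: "t \<ge> 0"
  shows "\<omega> t \<le> Linfty_norm \<omega>"
proof -
  let ?M = "lebesgue_on {0 :: real..}" and ?f = "\<lambda>t. ereal \<bar>\<omega> t\<bar>"
  define E where "E = esssup ?M ?f"
  have meas: "?f \<in> borel_measurable ?M"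
    using continuous_imp_measurable_on_sets_lebesgue[OF continuous_on_\<omega>] by simp
  obtain b where b: "\<And>s. s \<ge> 0 \<Longrightarrow> \<bar>\<omega> s\<bar> \<le> b" using bdd by (auto simp: bounded_iff)
  \<comment> \<open>This keeps \<open>E\<close> from being infinite, so that
    \<open>real_of_ereal\<close> returns it and not the default value \<open>0\<close>.\<close>
  have "E \<le> ereal b" unfolding E_def using b by (intro esssup_I meas AE_I2) auto
  moreover have "ereal (\<omega> t) \<le> E"
  proof (rule ccontr)
    assume less: "\<not> ereal (\<omega> t) \<le> E"
    have "AE s in ?M. ?f s \<le> E" unfolding E_def by (rule esssup_AE)
    then have "AE s in lebesgue. s \<in> {0..} \<longrightarrow> ?f s \<le> E"
      by (simp add: AE_restrict_space_iff)
    then have "AE s in lebesgue. s \<notin> {t..t+1}"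
    proof eventually_elim
      case (elim s)
      show ?case
      proof
        assume "s \<in> {t..t+1}"
        then have "\<omega> t \<le> \<bar>\<omega> s\<bar>" using \<omega>_mono[of t s] t by simp
        then show False using elim less \<open>s \<in> {t..t+1}\<close> t
          by (metis atLeastAtMost_iff atLeast_iff ereal_less_eq(3) order_trans)
      qed
    qed
    then have "emeasure lebesgue {t..t+1} = 0"
      by (subst (asm) AE_iff_measurable[of "{t..t+1}"]) auto
    then show False by simp
  qed
  ultimately show ?thesis
    unfolding Linfty_norm_def E_def[symmetric] by (cases E) auto
qed

text \<open>The function is a spike at \<open>0\<close> whose truncation never takes effect, and its
  height dominates \<open>\<omega> (3 * t)\<close> for all \<open>t\<close>.\<close>

lemma extremal_bounded:
  assumes "bounded (\<omega> ` {0..})"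
  shows "extremal N \<omega> (\<lambda>x. Linfty_norm \<omega> - \<omega> (N x))"
proof (rule extremalI)
  note le = \<omega>_le_Linfty_norm[OF assms]
  have eq: "(\<lambda>x. Linfty_norm \<omega> - \<omega> (N x)) = spike N \<omega> (Linfty_norm \<omega>) 0"
    using le by (auto simp: spike_def fun_eq_iff)
  show "Linfty_norm \<omega> - \<omega> (N x) \<ge> 0" for x using le by simp
  show "\<bar>Linfty_norm \<omega> - \<omega> (N x) - (Linfty_norm \<omega> - \<omega> (N y))\<bar> \<le> \<omega> (N (x - y))" for x y
    using \<omega>_N_diff[of x y] by simp
  fix t :: real assume "t > 0"
  then show "\<exists>a h. \<omega> (3 * t) \<le> h \<and> (\<forall>x. N (x - a) \<le> t \<longrightarrow>
      Linfty_norm \<omega> - \<omega> (N x) = spike N \<omega> h a x \<and>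
      maximal N (\<lambda>x. Linfty_norm \<omega> - \<omega> (N x)) x = maximal N (spike N \<omega> h a) x)"
    using le[of "3 * t"] by (intro exI[of _ 0] exI[of _ "Linfty_norm \<omega>"]) (simp add: eq fun_cong[OF eq])
qed

subsection \<open>Sums of spikes\<close>

lemma spike_le_spike_sum:
  assumes "\<And>x. summable (\<lambda>n. spike N \<omega> (\<Omega> n) (a n) x)"
  shows "spike N \<omega> (\<Omega> n) (a n) x \<le> spike_sum N \<omega> \<Omega> a x"
  using sum_le_suminf[OF assms, of "{n}" x] by (simp add: spike_sum_def spike_nonneg)

lemma obtain_large_\<omega>:
  assumes "\<not> bounded (\<omega> ` {0..})"
  obtains s where "s > 0" "K \<le> \<omega> s"
proof -
  obtain s where s: "s \<ge> 0" "K < \<omega> s"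
    using assms \<omega>_nonneg unfolding bounded_iff by (metis abs_of_nonneg atLeast_iff imageE not_le real_norm_def)
  then show ?thesis using \<omega>_mono[of s "s + 1"] by (intro that[of "s + 1"]) auto
qed

lemma spike_eq_0:
  assumes "h \<le> \<omega> \<rho>" "\<rho> \<ge> 0" "y \<notin> norm_ball N a \<rho>"
  shows "spike N \<omega> h a y = 0"
  using assms \<omega>_mono[of \<rho> "N (y - a)"] by (simp add: spike_def mem_norm_ball)

text \<open>At a common point of two supports the second spike would strictly raise the maximal
  function of the first, against the required equality. Unboundedness of \<open>\<omega>\<close>
  makes the supports bounded, as strict growth demands.\<close>

lemma fast_diverging_disjoint:
  assumes unb: "\<not> bounded (\<omega> ` {0..})" and fast: "fast_diverging N \<omega> \<Omega> a" and "m \<noteq> n"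
    and pos: "spike N \<omega> (\<Omega> m) (a m) x \<noteq> 0" "spike N \<omega> (\<Omega> n) (a n) x \<noteq> 0"
  shows False
proof -
  let ?f = "\<lambda>n. spike N \<omega> (\<Omega> n) (a n)"
  have summable: "summable (\<lambda>n. ?f n x)" for x using fast by (simp add: fast_diverging_def)
  have sum_le: "?f m y + ?f n y \<le> spike_sum N \<omega> \<Omega> a y" for y
    using sum_le_suminf[OF summable, of "{m, n}" y] \<open>m \<noteq> n\<close> by (simp add: spike_sum_def spike_nonneg)
  obtain \<rho> where \<rho>: "\<rho> > 0" "\<Omega> m \<le> \<omega> \<rho>" by (rule obtain_large_\<omega>[OF unb])
  have "maximal N (?f m) x < maximal N (\<lambda>y. ?f m y + ?f n y) x"
  proof (rule maximal_less_maximal_add[where h = "max 0 (\<Omega> m)" and \<rho> = \<rho> and z = "a m"])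
    show "?f m y \<le> max 0 (\<Omega> m)" for y
      using \<omega>_nonneg[of "N (y - a m)"] by (auto simp: spike_def)
  qed (use \<rho> pos spike_nonneg in \<open>auto simp: continuous_on_spike spike_eq_0 order_less_le\<close>)
  also have "\<dots> \<le> maximal N (spike_sum N \<omega> \<Omega> a) x"
    using sum_le by (intro maximal_mono) (smt (verit) spike_nonneg)
  also have "\<dots> = maximal N (?f m) x"
    using fast pos closure_subset unfolding fast_diverging_def by (metis (mono_tags, lifting) mem_Collect_eq subsetD)
  finally show False by simp
qed

lemma extremal_spike_sum:
  assumes unb: "\<not> bounded (\<omega> ` {0..})" and lim: "filterlim \<Omega> at_top sequentially"
    and fast: "fast_diverging N \<omega> \<Omega> a"
  shows "extremal N \<omega> (spike_sum N \<omega> \<Omega> a)"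
proof (rule extremalI)
  let ?f = "\<lambda>n. spike N \<omega> (\<Omega> n) (a n)" and ?\<psi> = "spike_sum N \<omega> \<Omega> a"
  have summable: "summable (\<lambda>n. ?f n x)" for x using fast by (simp add: fast_diverging_def)
  show nonneg: "?\<psi> x \<ge> 0" for x
    unfolding spike_sum_def by (intro suminf_nonneg summable spike_nonneg)
  have eq: "?\<psi> x = ?f n x" if "?f n x \<noteq> 0" for n x
    unfolding spike_sum_def
    using suminf_finite[of "{n}" "\<lambda>n. ?f n x"] fast_diverging_disjoint[OF unb fast] that by auto
  \<comment> \<open>A one-sided comparison suffices: \<open>?\<psi>\<close> equals a single spike at
    \<open>x\<close> and dominates that same spike at \<open>y\<close>.\<close>
  have "?\<psi> x - ?\<psi> y \<le> \<omega> (N (x - y))" for x y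
  proof (cases "\<exists>n. ?f n x \<noteq> 0")
    case True
    then obtain n where "?f n x \<noteq> 0" by blast
    then have "?\<psi> x - ?\<psi> y \<le> ?f n x - ?f n y"
      using eq spike_le_spike_sum[OF summable, of n y] by simp
    also have "\<dots> \<le> \<omega> (N (x - y))" using spike_diff[of "\<Omega> n" "a n" x y] by simp
    finally show ?thesis .
  next
    case False
    then have "?\<psi> x = 0" by (simp add: spike_sum_def)
    then show ?thesis using nonneg[of y] \<omega>_nonneg[of "N (x - y)"] by simp
  qed
  from this[of x y for x y] this[of y x for x y]
  show "\<bar>?\<psi> x - ?\<psi> y\<bar> \<le> \<omega> (N (x - y))" for x y
    by (metis N_minus_commute abs_le_iff minus_diff_eq)
  fix t :: real assume t: "t > 0"
  \<comment> \<open>The strict inequality makes the spike nonzero on the whole ball of radius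
    \<open>t\<close> around \<open>a n\<close>, where disjointness and the identity of maximal
    functions are available.\<close>
  obtain n where n: "\<Omega> n > \<omega> (3 * t)"
    using lim by (auto simp: filterlim_at_top_dense eventually_sequentially)
  show "\<exists>a h. \<omega> (3 * t) \<le> h \<and> (\<forall>x. N (x - a) \<le> t \<longrightarrow>
      ?\<psi> x = spike N \<omega> h a x \<and> maximal N ?\<psi> x = maximal N (spike N \<omega> h a) x)"
  proof (intro exI[of _ "a n"] exI[of _ "\<Omega> n"] conjI allI impI)
    fix x assume "N (x - a n) \<le> t"
    then have "\<omega> (N (x - a n)) \<le> \<omega> (3 * t)" using t by (intro \<omega>_mono) auto
    then have ne: "?f n x \<noteq> 0" using n by (simp add: spike_def)
    then show "?\<psi> x = ?f n x" by (rule eq)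
    show "maximal N ?\<psi> x = maximal N (?f n) x"
      using fast ne closure_subset unfolding fast_diverging_def
      by (metis (mono_tags, lifting) mem_Collect_eq subsetD)
  qed (use n in simp)
qed

text \<open>The ball of radius \<open>\<rho>\<close> around the peak contains every such
  \<open>x\<close>, and on a smaller concentric ball the spike is at least \<open>h / 2\<close>. The
  bound is uniform in \<open>a\<close>, so it can be fixed before the peaks are placed.\<close>

lemma maximal_spike_lower_bound:
  assumes h: "h > 0" and \<rho>: "\<rho> > 0"
  shows "\<exists>q>0. \<forall>a x. N (x - a) \<le> \<rho> \<longrightarrow> ennreal q \<le> maximal N (spike N \<omega> h a) x"
proof -
  obtain d where d: "d > 0" "\<And>s. 0 \<le> s \<Longrightarrow> s \<le> d \<Longrightarrow> \<omega> s < h / 2"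
    using small_\<omega>[of "h / 2"] h by auto
  define \<sigma> where "\<sigma> = min d \<rho>"
  have \<sigma>: "\<sigma> > 0" "\<sigma> \<le> \<rho>" "\<sigma> \<le> d" using d \<rho> by (auto simp: \<sigma>_def)
  have "ennreal (h / 2 * (\<sigma> / \<rho>) ^ CARD('n)) \<le> maximal N (spike N \<omega> h a) x"
    if "N (x - a) \<le> \<rho>" for a x
  proof -
    have "h / 2 \<le> \<bar>spike N \<omega> h a y\<bar>" if "y \<in> norm_ball N a \<sigma>" for y
      using d(2)[of "N (y - a)"] \<sigma> that by (auto simp: spike_def mem_norm_ball max_def)
    then have "ennreal (h / 2 * (\<sigma> / \<rho>) ^ CARD('n)) \<le> ball_average N a \<rho> (\<lambda>y. ennreal \<bar>spike N \<omega> h a y\<bar>)"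
      using \<sigma> \<rho> h by (intro ball_average_ge_subball ennreal_leI) (auto simp: mem_norm_ball)
    also have "\<dots> \<le> maximal N (spike N \<omega> h a) x" using \<rho> that by (intro ball_average_le_maximal)
    finally show ?thesis .
  qed
  moreover have "h / 2 * (\<sigma> / \<rho>) ^ CARD('n) > 0" using h \<sigma> \<rho> by simp
  ultimately show ?thesis by blast
qed

text \<open>A ball that meets the supports of two spikes, the later one with index \<open>k\<close>, has radius at
  least \<open>T k\<close>. This \<open>T k\<close> is chosen so that the \<open>i\<close>-th spike contributes at most
  \<open>q j / 2 ^ Suc i\<close> to the average over such a ball whenever \<open>i, j \<le> k\<close>, where \<open>q j\<close> is a lower
  bound of the maximal function of the \<open>j\<close>-th spike on its support.\<close>

lemma fast_diverging_exists:
  assumes unb: "\<not> bounded (\<omega> ` {0..})"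
  shows "\<exists>a. fast_diverging N \<omega> \<Omega> a"
proof -
  have "\<exists>s>0. \<Omega> k \<le> \<omega> s" for k using obtain_large_\<omega>[OF unb, of "\<Omega> k"] by blast
  then obtain r where r: "\<And>k. r k > 0" "\<And>k. \<Omega> k \<le> \<omega> (r k)" by metis
  \<comment> \<open>Partial sums give support radii that increase with the index.\<close>
  define \<rho> where "\<rho> k = (\<Sum>i\<le>k. r i)" for k
  have \<rho>_ge: "\<rho> k \<ge> r k" for k
    unfolding \<rho>_def using r(1) by (intro member_le_sum) (auto intro: less_imp_le)
  have \<rho>: "\<rho> k > 0" "\<Omega> k \<le> \<omega> (\<rho> k)" for k
    using r(1)[of k] r(2)[of k] \<rho>_ge[of k] \<omega>_mono[of "r k" "\<rho> k"] by auto
  have \<rho>_mono: "\<rho> i \<le> \<rho> j" if "i \<le> j" for i j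
    unfolding \<rho>_def using that r(1) by (intro sum_mono2) (auto intro: less_imp_le)
  \<comment> \<open>Indices of nonpositive height get a dummy value, so that \<open>q\<close> is
    positive throughout and may be divided by.\<close>
  have "\<exists>q>0. \<Omega> j > 0 \<longrightarrow> (\<forall>a x. N (x - a) \<le> \<rho> j \<longrightarrow> ennreal q \<le> maximal N (spike N \<omega> (\<Omega> j) a) x)" for j
  proof (cases "\<Omega> j > 0")
    case True
    then show ?thesis using maximal_spike_lower_bound[OF True \<rho>(1)[of j]] by blast
  qed (auto intro: exI[of _ 1])
  then obtain q where q: "\<And>j. q j > 0"
    "\<And>j a x. \<Omega> j > 0 \<Longrightarrow> N (x - a) \<le> \<rho> j \<Longrightarrow> ennreal (q j) \<le> maximal N (spike N \<omega> (\<Omega> j) a) x" by metis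
  define h where "h k = max 0 (\<Omega> k)" for k
  \<comment> \<open>With \<open>d = CARD('n)\<close>, this solves
    \<open>h i * (\<rho> i / R) ^ d \<le> q j / 2 ^ Suc i\<close> for \<open>R ^ d\<close>.\<close>
  define C where "C i j = 2 ^ Suc i * h i * \<rho> i ^ CARD('n) / q j" for i j
  have C: "C i j \<ge> 0" for i j
    using q(1)[of j] \<rho>(1)[of i] by (simp add: C_def h_def)
  \<comment> \<open>The double sum dominates each \<open>C i j\<close>; the extra \<open>1\<close>
    forces \<open>R \<ge> 1\<close>, so that \<open>R \<le> R ^ d\<close> and a bound on
    \<open>R\<close> itself suffices.\<close>
  define T where "T k = 1 + (\<Sum>i\<le>k. \<Sum>j\<le>k. C i j)" for k
  have T_ge_1: "T k \<ge> 1" for k unfolding T_def using C by (simp add: sum_nonneg)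
  have T_ge_C: "C i j \<le> T k" if "i \<le> k" "j \<le> k" for i j k
  proof -
    have "C i j \<le> (\<Sum>j\<le>k. C i j)" using that C by (intro member_le_sum) auto
    also have "\<dots> \<le> (\<Sum>i\<le>k. \<Sum>j\<le>k. C i j)"
      using that C by (intro member_le_sum[where f = "\<lambda>i. \<Sum>j\<le>k. C i j"] sum_nonneg) auto
    finally show ?thesis by (simp add: T_def)
  qed
  have T_mono: "T k \<le> T l" if "k \<le> l" for k l
  proof -
    have "(\<Sum>i\<le>k. \<Sum>j\<le>k. C i j) \<le> (\<Sum>i\<le>k. \<Sum>j\<le>l. C i j)"
      using that C by (intro sum_mono sum_mono2) auto
    also have "\<dots> \<le> (\<Sum>i\<le>l. \<Sum>j\<le>l. C i j)"
      using that C by (intro sum_mono2 sum_nonneg) auto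
    finally show ?thesis by (simp add: T_def)
  qed
  have gap: "1 \<le> 2 * T i + 2 * \<rho> i" for i using T_ge_1[of i] \<rho>(1)[of i] by linarith
  \<comment> \<open>The peaks lie on one ray, with a gap before the \<open>k\<close>-th that
    accounts for both supports and for a diameter \<open>2 * T k\<close>.\<close>
  define s where "s k = (\<Sum>i\<le>k. 2 * T i + 2 * \<rho> i)" for k
  have s_diff: "s j + 2 * T k + 2 * \<rho> k \<le> s k" if "j < k" for j k
  proof -
    have "(\<Sum>i\<in>insert k {..j}. 2 * T i + 2 * \<rho> i) \<le> s k"
      unfolding s_def using that gap by (intro sum_mono2) (auto intro: order_trans[OF zero_le_one])
    then show ?thesis using that by (simp add: s_def)
  qed
  obtain v where v: "N v = 1" by (rule is_norm_obtain_unit[OF is_norm])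
  define a where "a k = s k *\<^sub>R v" for k
  let ?f = "\<lambda>n. spike N \<omega> (\<Omega> n) (a n)" and ?\<psi> = "spike_sum N \<omega> \<Omega> a"
  have dist: "2 * T (max j k) + \<rho> j + \<rho> k \<le> N (a j - a k)" if "j \<noteq> k" for j k
  proof -
    have "N (a j - a k) = \<bar>s j - s k\<bar>" using v by (simp add: a_def flip: scaleR_diff_left)
    moreover have "s j + 2 * T k + \<rho> j + \<rho> k \<le> s k" if "j < k" for j k
      using s_diff[OF that] \<rho>_mono[of j k] that by simp
    ultimately show ?thesis
      using that by (cases j k rule: linorder_cases) (force simp: max_def)+
  qed
  have supp: "N (y - a k) \<le> \<rho> k" if "?f k y \<noteq> 0" for k y
    using spike_eq_0[of "\<Omega> k" "\<rho> k" y "a k"] \<rho>[of k] that by (auto simp: mem_norm_ball)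
  have summable: "summable (\<lambda>n. ?f n x)" for x
  proof -
    \<comment> \<open>The centres are further apart than the sum of the two support radii, so at
      most one term is nonzero at \<open>x\<close>.\<close>
    have "m = n" if "?f m x \<noteq> 0" "?f n x \<noteq> 0" for m n
    proof (rule ccontr)
      assume "m \<noteq> n"
      then show False
        using dist[of m n] supp[OF that(1)] supp[OF that(2)] N_triangle[of "a m - x" "x - a n"]
          N_minus_commute[of x "a m"] T_ge_1[of "max m n"] by simp
    qed
    then have "is_singleton {n. ?f n x \<noteq> 0} \<or> {n. ?f n x \<noteq> 0} = {}"
      by (auto intro: is_singletonI')
    then have "finite {n. ?f n x \<noteq> 0}" by (auto simp: is_singleton_def)
    then show ?thesis by (intro summable_finite) auto
  qed
  have "filterlim a at_infinity sequentially"
  proof -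
    have s_ge: "real k \<le> s k" for k
    proof -
      have "(\<Sum>i\<le>k. 1) \<le> s k" unfolding s_def
        using gap by (intro sum_mono)
      then show ?thesis by simp
    qed
    have "v \<noteq> 0" using v by auto
    have "filterlim (\<lambda>k. real k * norm v) at_top sequentially"
      using \<open>v \<noteq> 0\<close> filterlim_real_sequentially by (intro filterlim_at_top_mult_tendsto_pos[OF tendsto_const]) auto
    then have "filterlim (\<lambda>k. norm (a k)) at_top sequentially"
    proof (rule filterlim_at_top_mono)
      show "\<forall>\<^sub>F k in sequentially. real k * norm v \<le> norm (a k)"
        using s_ge by (intro always_eventually allI) (simp add: a_def mult_right_mono order_trans[OF _ abs_ge_self])
    qed
    then show ?thesis by (simp add: filterlim_at_infinity_conv_norm_at_top)
  qed
  moreover have "maximal N ?\<psi> x = maximal N (?f n) x" if x: "x \<in> closure {x. ?f n x \<noteq> 0}" for n x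
  proof (rule antisym)
    show "maximal N (?f n) x \<le> maximal N ?\<psi> x"
      using spike_le_spike_sum[OF summable] spike_nonneg by (intro maximal_mono) (smt (verit))
    \<comment> \<open>The closed ball also captures boundary points of the support, where the spike
      vanishes but the lower bound \<open>q n\<close> still holds.\<close>
    have "closure {x. ?f n x \<noteq> 0} \<subseteq> norm_ball N (a n) (\<rho> n)"
      using supp compact_norm_ball by (intro closure_minimal compact_imp_closed) (auto simp: mem_norm_ball)
    then have x_near: "N (x - a n) \<le> \<rho> n" using x by (auto simp: mem_norm_ball)
    have "\<Omega> n > 0"
    proof (rule ccontr)
      assume "\<not> \<Omega> n > 0"
      then have "?f n y = 0" for y using \<omega>_nonneg[of "N (y - a n)"] by (simp add: spike_def)
      then show False using x by simp
    qed
    then have q_le: "ennreal (q n) \<le> maximal N (?f n) x" using q(2) x_near by blast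
    show "maximal N ?\<psi> x \<le> maximal N (?f n) x"
    proof (rule maximal_leI)
      fix c R assume R: "R > 0" "N (x - c) \<le> R"
      \<comment> \<open>The path from \<open>a n\<close> through \<open>x\<close>, \<open>c\<close>,
        \<open>y\<close> to \<open>a k\<close> has length at most
        \<open>\<rho> n + R + R + \<rho> k\<close>, so \<open>2 * R\<close> covers the gap
        \<open>2 * T\<close>.\<close>
      have T_le: "T (max n k) \<le> R" if "k \<noteq> n" "y \<in> norm_ball N c R" "?f k y \<noteq> 0" for k y
      proof -
        have "N (a n - a k) \<le> N (a n - x) + N (x - c) + N (c - y) + N (y - a k)"
          using N_triangle[of "a n - x" "x - a k"] N_triangle[of "x - c" "c - a k"] N_triangle[of "c - y" "y - a k"]
          by simp
        then show ?thesis
          using dist[of n k] that x_near supp[OF that(3)] R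
            N_minus_commute[of x "a n"] N_minus_commute[of c y] by (simp add: mem_norm_ball)
      qed
      \<comment> \<open>Either the ball meets no spike except the \<open>n\<close>-th, and the
        averages agree, or it is so large that the average of the entire sum is at most
        \<open>q n\<close>.\<close>
      show "ball_average N c R (\<lambda>y. ennreal \<bar>?\<psi> y\<bar>) \<le> maximal N (?f n) x"
      proof (cases "\<exists>k y. k \<noteq> n \<and> y \<in> norm_ball N c R \<and> ?f k y \<noteq> 0")
        case False
        then have "?\<psi> y = ?f n y" if "y \<in> norm_ball N c R" for y
          unfolding spike_sum_def using suminf_finite[of "{n}" "\<lambda>n. ?f n y"] that by auto
        then have "ball_average N c R (\<lambda>y. ennreal \<bar>?\<psi> y\<bar>) = ball_average N c R (\<lambda>y. ennreal \<bar>?f n y\<bar>)"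
          by (intro ball_average_cong) simp
        then show ?thesis using ball_average_le_maximal[OF R] by metis
      next
        case True
        then have T_n: "T n \<le> R" using T_le T_mono[of n "max n _"] by (metis max.cobounded1 order_trans)
        then have "R \<ge> 1" using T_ge_1[of n] by simp
        \<comment> \<open>The case \<open>k = n\<close> is included, by \<open>T n \<le> R\<close>;
          spikes that miss the ball contribute \<open>0\<close>.\<close>
        have avg: "ball_average N c R (\<lambda>y. ennreal (?f k y)) \<le> ennreal (q n * (1 / 2) ^ Suc k)" for k
        proof (cases "\<exists>y \<in> norm_ball N c R. ?f k y \<noteq> 0")
          case True
          then have "T (max n k) \<le> R" using T_le T_n by (cases "k = n") auto
          then have "C k n \<le> R" using T_ge_C[of k "max n k" n] by simp
          also have "R \<le> R ^ CARD('n)" using \<open>R \<ge> 1\<close> by (intro self_le_power) auto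
          finally have "h k * (\<rho> k / R) ^ CARD('n) \<le> q n * (1 / 2) ^ Suc k"
            using q(1)[of n] R by (simp add: C_def field_simps)
          moreover have "ball_average N c R (\<lambda>y. ennreal (?f k y)) \<le> ennreal (h k * (\<rho> k / R) ^ CARD('n))"
          proof (rule ball_average_le_support[where z = "a k"])
            show "ennreal (?f k y) \<le> ennreal (h k)" for y
              using \<omega>_nonneg[of "N (y - a k)"] by (intro ennreal_leI) (auto simp: spike_def h_def)
            show "ennreal (?f k y) = 0" if "y \<notin> norm_ball N (a k) (\<rho> k)" for y
              using supp[of k y] that by (metis ennreal_0 mem_norm_ball)
          qed (use \<rho> R in \<open>auto simp: h_def\<close>)
          ultimately show ?thesis by (meson ennreal_leI order_trans)
        next
          case False
          then have "ball_average N c R (\<lambda>y. ennreal (?f k y)) = ball_average N c R (\<lambda>_. 0)"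
            by (intro ball_average_cong) simp
          then show ?thesis using R by (simp add: ball_average_const)
        qed
        \<comment> \<open>As a series in \<open>ennreal\<close>, the sum may be exchanged with the
          average; the geometric weights then add up to \<open>q n\<close>.\<close>
        have "ennreal \<bar>?\<psi> y\<bar> = (\<Sum>k. ennreal (?f k y))" for y
          using suminf_ennreal2[OF spike_nonneg summable] suminf_nonneg[OF summable spike_nonneg]
          by (simp add: spike_sum_def)
        then have "ball_average N c R (\<lambda>y. ennreal \<bar>?\<psi> y\<bar>) = (\<Sum>k. ball_average N c R (\<lambda>y. ennreal (?f k y)))"
          using borel_measurable_continuous_lebesgue[OF continuous_on_spike]
          by (simp add: ball_average_suminf)
        also have "\<dots> \<le> (\<Sum>k. ennreal (q n * (1 / 2) ^ Suc k))"
          by (intro suminf_le avg summableI)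
        also have "\<dots> = ennreal (q n)"
          using sums_mult[OF power_half_series, of "q n"] q(1)[of n] by (intro suminf_ennreal_eq) auto
        finally show ?thesis using q_le by (rule order_trans)
      qed
    qed
  qed
  ultimately show ?thesis unfolding fast_diverging_def using summable by blast
qed

end

section \<open>Assembly of the four claims\<close>

theorem theorem2p7:
  fixes N :: "real ^ 'n \<Rightarrow> real"
  assumes "is_norm N"
  shows "(\<forall>f t. locally_integrable f \<and> t \<ge> 0 \<longrightarrow>
            modulus_maximal N f t \<le> modulus_bound N (modulus_real N (\<lambda>x. \<bar>f x\<bar>)) t)
       \<and> (\<forall>\<omega>. is_modulus \<omega> \<longrightarrow>
            (\<exists>\<psi>. extremal N \<omega> \<psi>)
          \<and> (\<forall>v t. N v = 1 \<and> t > 0 \<longrightarrow>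
               (INF (c, R) \<in> admissible_small N v. scaled_average N (\<lambda>s. ennreal (\<omega> s)) t c R)
             = (INF (c, R) \<in> admissible N v. scaled_average N (\<lambda>s. ennreal (\<omega> s)) t c R))
          \<and> (bounded (\<omega> ` {0..}) \<longrightarrow> extremal N \<omega> (\<lambda>x. Linfty_norm \<omega> - \<omega> (N x)))
          \<and> (\<not> bounded (\<omega> ` {0..}) \<longrightarrow>
               (\<forall>\<Omega>. incseq \<Omega> \<and> filterlim \<Omega> at_top sequentially \<longrightarrow>
                  (\<exists>a. fast_diverging N \<omega> \<Omega> a)
                \<and> (\<forall>a. fast_diverging N \<omega> \<Omega> a \<longrightarrow> extremal N \<omega> (spike_sum N \<omega> \<Omega> a)))))"
proof (intro conjI allI impI)
  interpret cart_norm N by unfold_locales (rule assms)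
  fix f :: "real ^ 'n \<Rightarrow> real" and t :: real
  assume "locally_integrable f \<and> t \<ge> 0"
  then show "modulus_maximal N f t \<le> modulus_bound N (modulus_real N (\<lambda>x. \<bar>f x\<bar>)) t"
    by (intro modulus_maximal_le borel_measurable_locally_integrable) simp
next
  fix \<omega> assume \<omega>: "is_modulus \<omega>"
  interpret cart_norm_modulus N \<omega> by unfold_locales (rule assms, rule \<omega>)
  show "\<exists>\<psi>. extremal N \<omega> \<psi>"
  proof (cases "bounded (\<omega> ` {0..})")
    case True
    then show ?thesis using extremal_bounded by blast
  next
    case False
    then show ?thesis
      \<comment> \<open>The heights are chosen as \<open>\<Omega> n = real n\<close>.\<close>
      using fast_diverging_exists extremal_spike_sum[OF False filterlim_real_sequentially] by blast
  qed
  show "(INF (c, R) \<in> admissible_small N v. scaled_average N (\<lambda>s. ennreal (\<omega> s)) t c R)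
      = (INF (c, R) \<in> admissible N v. scaled_average N (\<lambda>s. ennreal (\<omega> s)) t c R)"
    if "N v = 1 \<and> t > 0" for v t
    using that by (intro INF_admissible_small mono_on_\<omega>) auto
  show "extremal N \<omega> (\<lambda>x. Linfty_norm \<omega> - \<omega> (N x))" if "bounded (\<omega> ` {0..})"
    by (rule extremal_bounded[OF that])
  show "\<exists>a. fast_diverging N \<omega> \<Omega> a" if "\<not> bounded (\<omega> ` {0..})" for \<Omega>
    by (rule fast_diverging_exists[OF that])
  show "extremal N \<omega> (spike_sum N \<omega> \<Omega> a)"
    if "\<not> bounded (\<omega> ` {0..})" "incseq \<Omega> \<and> filterlim \<Omega> at_top sequentially" "fast_diverging N \<omega> \<Omega> a" for \<Omega> a
    using that extremal_spike_sum by blast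
qed

end
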